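(* Let $(X,d)$ be a locally compact Polish metric space. Then for every $a,b>0$, $\mu,\nu\in \mathcal{M}(X)$ and $p\geq 1$: \begin{enumerate} \item $\displaystyle\widetilde{W}^{a,b}_p(\mu,\nu)^p=\sup_{(\varphi_1,\varphi_2)\in\Phi_W}\left\{ \int_X I(\varphi_1(x))\, d\mu(x)+\int_X I(\varphi_2(x))\, d\nu(x)\right\},$ where $$\Phi_W:= \{(\varphi_1,\varphi_2)\in C_b(X)\times C_b(X) : \varphi_1(x)+\varphi_2 (y)\leq (b\, d(x,y))^p\text{ and }\varphi_1 (x), \varphi _2(y)\geq -a\ \ \forall x,y\in X\};$$ \item $\displaystyle\widetilde{W}_1^{a,b}(\mu,\nu)=\sup\left\{\int_X f\,d(\mu-\nu):f\in \mathbb{F}\right\},$ where $\mathbb{F}:=\{f\in C_b(X): \|f\|_\infty\leq a,\ \|f\|_{Lip}\leq b\}.$ \end{enumerate}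
   Context: $\mathcal{M}(X)$ is the set of nonnegative finite Borel measures on $X$; $\mathcal{M}_p(X)$ is the subset of those with finite $p$-moment, i.e. $\int_X d^p(x,x_0)\,d\mu(x)<\infty$ for some (hence any) $x_0\in X$. For a finite signed Borel measure $\mu=\mu^+-\mu^-$, $|\mu|:=\mu^+(X)+\mu^-(X)$. $C_b(X)$ is the space of bounded continuous real functions, and $\|f\|_{Lip}:=\sup_{x\ne y}\frac{|f(x)-f(y)|}{d(x,y)}$. For $\mu_1,\mu_2\in\mathcal{M}_p(X)$ with $|\mu_1|=|\mu_2|$, $W_p(\mu_1,\mu_2):=\left(|\mu_1|\inf_{\boldsymbol\pi\in\Pi(\mu_1,\mu_2)}\int_{X\times X}d^p(x,y)\,d\boldsymbol\pi(x,y)\right)^{1/p}$, where $\Pi(\mu_1,\mu_2)$ is the set of Borel probability measures $\boldsymbol\pi$ on $X\times X$ with $|\mu_1|\boldsymbol\pi(A\times X)=\mu_1(A)$ and $|\mu_2|\boldsymbol\pi(X\times B)=\mu_2(B)$ for all Borel $A,B$. The generalized Wasserstein distance is, for $\mu_1,\mu_2\in\mathcal{M}(X)$, $$\widetilde{W}^{a,b}_p(\mu_1,\mu_2):=\left(\inf\left\{a|\mu_1-\widetilde\mu_1|+a|\mu_2-\widetilde\mu_2|+b^pW_p^p(\widetilde\mu_1,\widetilde\mu_2):\ \widetilde\mu_1,\widetilde\mu_2\in\mathcal{M}_p(X),\ |\widetilde\mu_1|=|\widetilde\mu_2|\right\}\right)^{1/p}.$$ The function $I$ is $I(\varphi):=\inf_{s\ge0}(s\varphi+a|1-s|)$,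 i.e. $I(\varphi)=a$ if $\varphi>a$, $I(\varphi)=\varphi$ if $-a\le\varphi\le a$, and $I(\varphi)=-\infty$ if $\varphi<-a$. *)

theory Defs
  imports "HOL-Probability.Probability"
begin

definition finite_borel_measures :: "'a::topological_space measure set" where
  "finite_borel_measures = {\<mu>. finite_measure \<mu> \<and> sets \<mu> = sets borel}"

definition finite_moment_measures :: "real \<Rightarrow> 'a::metric_space measure set" where
  "finite_moment_measures p =
     {\<mu> \<in> finite_borel_measures. \<exists>x0. (\<integral>\<^sup>+x. ennreal (dist x x0 powr p) \<partial>\<mu>) < \<infinity>}"


section \<open>Signed measures\<close>

text \<open>
  The library has no type of signed measures. A finite signed Borel measure is represented by its
  real-valued set function, of which only the values on Borel sets matter. Its total variation and
  the integral against it are defined through its Jordan decomposition.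
\<close>

definition signed_diff :: "'a measure \<Rightarrow> 'a measure \<Rightarrow> 'a set \<Rightarrow> real" where
  "signed_diff \<mu> \<nu> = (\<lambda>A. measure \<mu> A - measure \<nu> A)"

definition is_jordan_decomposition ::
    "('a::topological_space set \<Rightarrow> real) \<Rightarrow> 'a measure \<times> 'a measure \<Rightarrow> bool" where
  "is_jordan_decomposition \<sigma> = (\<lambda>(P, N).
     P \<in> finite_borel_measures \<and> N \<in> finite_borel_measures \<and>
     (\<exists>S\<in>sets borel. emeasure P (- S) = 0 \<and> emeasure N S = 0) \<and>
     (\<forall>A\<in>sets borel. \<sigma> A = measure P A - measure N A))"

definition jordan_decomposition ::
    "('a::topological_space set \<Rightarrow> real) \<Rightarrow> 'a measure \<times> 'a measure" where
  "jordan_decomposition \<sigma> = (THE PN. is_jordan_decomposition \<sigma> PN)"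

definition total_variation :: "('a::topological_space set \<Rightarrow> real) \<Rightarrow> real" where
  "total_variation \<sigma> = (case jordan_decomposition \<sigma> of (P, N) \<Rightarrow> measure P UNIV + measure N UNIV)"

definition signed_integral :: "('a::topological_space set \<Rightarrow> real) \<Rightarrow> ('a \<Rightarrow> real) \<Rightarrow> real" where
  "signed_integral \<sigma> f =
     (case jordan_decomposition \<sigma> of (P, N) \<Rightarrow> (\<integral>x. f x \<partial>P) - (\<integral>x. f x \<partial>N))"

lemma is_jordan_decomposition_unique:
  assumes "is_jordan_decomposition \<sigma> PN" "is_jordan_decomposition \<sigma> PN'"
  shows "PN = PN'"
proof -
  have le: "measure P A \<le> measure P' A"
    if J: "is_jordan_decomposition \<sigma> (P, N)" and J': "is_jordan_decomposition \<sigma> (P', N')"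
      and A: "A \<in> sets borel" for P N P' N' A
  proof -
    from J obtain S where S: "S \<in> sets borel" "emeasure P (- S) = 0" "emeasure N S = 0"
      by (auto simp: is_jordan_decomposition_def)
    have fP: "finite_measure P" "finite_measure P'" and
      sP: "sets P = sets borel" "sets N = sets borel" "sets P' = sets borel"
      using J J' by (auto simp: is_jordan_decomposition_def finite_borel_measures_def)
    have AS: "A \<inter> S \<in> sets borel" using A S by auto
    have "emeasure P (A - S) \<le> emeasure P (- S)"
      using S sP by (intro emeasure_mono) auto
    moreover have "emeasure N (A \<inter> S) \<le> emeasure N S"
      using S sP by (intro emeasure_mono) auto
    ultimately have 0: "measure P (A - S) = 0" "measure N (A \<inter> S) = 0"
      using S by (auto simp: measure_def)
    have "measure P A = measure P (A \<inter> S) + measure P (A - S)"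
      using finite_measure.finite_measure_Union[OF fP(1), of "A \<inter> S" "A - S"] A S sP
      by (auto simp: Int_Diff_Un)
    also have "\<dots> = measure P' (A \<inter> S) - measure N' (A \<inter> S)"
      using J J' AS 0 by (auto simp: is_jordan_decomposition_def)
    also have "\<dots> \<le> measure P' (A \<inter> S)" by simp
    also have "\<dots> \<le> measure P' A"
      using finite_measure.finite_measure_mono[OF fP(2), of "A \<inter> S" A] A sP by auto
    finally show ?thesis .
  qed
  obtain P N P' N' where PN: "PN = (P, N)" "PN' = (P', N')" by fastforce
  note J = assms[unfolded PN]
  have fm: "finite_measure P" "finite_measure N" "finite_measure P'" "finite_measure N'"
    and s: "sets P = sets borel" "sets N = sets borel" "sets P' = sets borel" "sets N' = sets borel"
    using J by (auto simp: is_jordan_decomposition_def finite_borel_measures_def)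
  have mP: "measure P A = measure P' A" if "A \<in> sets borel" for A
    using le[OF J that] le[OF J(2) J(1) that] by simp
  have mN: "measure N A = measure N' A" if "A \<in> sets borel" for A
    using J mP that by (force simp: is_jordan_decomposition_def)
  have "P = P'" "N = N'"
    using fm s mP mN by (auto intro!: measure_eqI simp: finite_measure.emeasure_eq_measure)
  then show ?thesis by (simp add: PN)
qed

lemma is_jordan_decomposition_signed_diff_exists:
  assumes "\<mu> \<in> finite_borel_measures" "\<nu> \<in> finite_borel_measures"
  shows "\<exists>PN. is_jordan_decomposition (signed_diff \<mu> \<nu>) PN"
proof -
  have fm: "finite_measure \<mu>" "finite_measure \<nu>"
    and s[measurable_cong]: "sets \<mu> = sets borel" "sets \<nu> = sets borel"
    using assms by (auto simp: finite_borel_measures_def)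
  obtain Y where Y: "Y \<in> sets borel"
    "\<And>X. X \<in> sets borel \<Longrightarrow> X \<subseteq> Y \<Longrightarrow> emeasure \<nu> X \<le> emeasure \<mu> X"
    "\<And>X. X \<in> sets borel \<Longrightarrow> X \<inter> Y = {} \<Longrightarrow> emeasure \<mu> X \<le> emeasure \<nu> X"
    using finite_unsigned_Hahn_decomposition[OF fm] s by auto
  have d: "emeasure (density M (indicator Z)) A = emeasure M (A \<inter> Z)"
    if "sets M = sets borel" "A \<in> sets borel" "Z \<in> sets borel" for M :: "'a measure" and A Z
    using that
    by (subst emeasure_density)
      (auto simp: mult.commute simp flip: indicator_inter_arith intro!: borel_measurable_indicator)
  have fd: "finite_measure (density M (indicator Z))"
    if "sets M = sets borel" "finite_measure M" "Z \<in> sets borel" for M :: "'a measure" and Z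
  proof (rule finite_measureI)
    have "space M = UNIV" using that sets_eq_imp_space_eq[of M borel] by auto
    then show "emeasure (density M (indicator Z)) (space (density M (indicator Z))) \<noteq> \<infinity>"
      using d[OF that(1) _ that(3), of UNIV] finite_measure.emeasure_finite[OF that(2)] by auto
  qed
  define P where "P = diff_measure (density \<mu> (indicator Y)) (density \<nu> (indicator Y))"
  define N where "N = diff_measure (density \<nu> (indicator (- Y))) (density \<mu> (indicator (- Y)))"
  have P: "emeasure P A = emeasure \<mu> (A \<inter> Y) - emeasure \<nu> (A \<inter> Y)" if "A \<in> sets borel" for A
    unfolding P_def using that Y s fm
    by (subst emeasure_diff_measure) (auto simp: d intro!: fd)
  have cY: "- Y \<in> sets borel"
    using Y(1) borel_comp by blast
  have le_cY: "emeasure \<mu> (A \<inter> - Y) \<le> emeasure \<nu> (A \<inter> - Y)" if "A \<in> sets borel" for A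
    using that cY by (intro Y(3)) auto
  have N: "emeasure N A = emeasure \<nu> (A - Y) - emeasure \<mu> (A - Y)" if "A \<in> sets borel" for A
    unfolding N_def Diff_eq using that cY s fm le_cY
    by (subst emeasure_diff_measure) (auto simp: d intro!: fd)
  have sPN: "sets P = sets borel" "sets N = sets borel"
    using s by (auto simp: P_def N_def)
  have sp: "space P = UNIV" "space N = UNIV"
    using sPN sets_eq_imp_space_eq[of P borel] sets_eq_imp_space_eq[of N borel] by auto
  have fin: "finite_measure P" "finite_measure N"
    using fm by (auto intro!: finite_measureI simp: sp P N finite_measure.emeasure_eq_measure)
  have P': "measure P A = measure \<mu> (A \<inter> Y) - measure \<nu> (A \<inter> Y)" if "A \<in> sets borel" for A
  proof -
    have "A \<inter> Y \<in> sets borel" using that Y by auto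
    then have "measure \<nu> (A \<inter> Y) \<le> measure \<mu> (A \<inter> Y)"
      using Y(2)[of "A \<inter> Y"] fm by (auto simp: finite_measure.emeasure_eq_measure)
    then show ?thesis
      using P[OF that] fm by (simp add: measure_def[of P] finite_measure.emeasure_eq_measure[OF fm(1)]
          finite_measure.emeasure_eq_measure[OF fm(2)] ennreal_minus)
  qed
  have N': "measure N A = measure \<nu> (A - Y) - measure \<mu> (A - Y)" if "A \<in> sets borel" for A
  proof -
    have "A - Y \<in> sets borel" using that Y by auto
    then have "measure \<mu> (A - Y) \<le> measure \<nu> (A - Y)"
      using Y(3)[of "A - Y"] fm by (auto simp: finite_measure.emeasure_eq_measure)
    then show ?thesis
      using N[OF that] fm by (simp add: measure_def[of N] finite_measure.emeasure_eq_measure[OF fm(1)]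
          finite_measure.emeasure_eq_measure[OF fm(2)] ennreal_minus)
  qed
  have split: "measure M A = measure M (A \<inter> Y) + measure M (A - Y)"
    if "finite_measure M" "sets M = sets borel" "A \<in> sets borel" for M A
    using finite_measure.finite_measure_Union[OF that(1), of "A \<inter> Y" "A - Y"] that Y
    by (auto simp: Int_Diff_Un)
  have "is_jordan_decomposition (signed_diff \<mu> \<nu>) (P, N)"
    unfolding is_jordan_decomposition_def prod.case
  proof (intro conjI ballI bexI[OF _ Y(1)])
    show "emeasure P (- Y) = 0" "emeasure N Y = 0"
      using Y by (auto simp: P N)
    show "signed_diff \<mu> \<nu> A = measure P A - measure N A" if "A \<in> sets borel" for A
      using P'[OF that] N'[OF that] split[OF fm(1) s(1) that] split[OF fm(2) s(2) that]
      by (simp add: signed_diff_def)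
  qed (use fin sPN in \<open>auto simp: finite_borel_measures_def\<close>)
  then show ?thesis by blast
qed

lemma is_jordan_decomposition_jordan_decomposition:
  assumes "\<mu> \<in> finite_borel_measures" "\<nu> \<in> finite_borel_measures"
  shows "is_jordan_decomposition (signed_diff \<mu> \<nu>) (jordan_decomposition (signed_diff \<mu> \<nu>))"
  unfolding jordan_decomposition_def
  by (rule theI') (metis assms is_jordan_decomposition_signed_diff_exists
      is_jordan_decomposition_unique)


section \<open>Wasserstein and generalized Wasserstein distances\<close>

definition transport_plans ::
    "'a::topological_space measure \<Rightarrow> 'a measure \<Rightarrow> ('a \<times> 'a) measure set" where
  "transport_plans \<mu>1 \<mu>2 = {\<pi>. prob_space \<pi> \<and> sets \<pi> = sets borel \<and>
     (\<forall>A\<in>sets borel. measure \<mu>1 UNIV * measure \<pi> (A \<times> UNIV) = measure \<mu>1 A) \<and>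
     (\<forall>B\<in>sets borel. measure \<mu>2 UNIV * measure \<pi> (UNIV \<times> B) = measure \<mu>2 B)}"

text \<open>
  For measures of equal mass with finite \<open>p\<close>-moment, the only ones to which this is applied, the
  infimum is finite, so \<^const>\<open>enn2real\<close> loses nothing.
\<close>

definition wasserstein :: "real \<Rightarrow> 'a::metric_space measure \<Rightarrow> 'a measure \<Rightarrow> real" where
  "wasserstein p \<mu>1 \<mu>2 =
     (measure \<mu>1 UNIV *
      enn2real (INF \<pi>\<in>transport_plans \<mu>1 \<mu>2. \<integral>\<^sup>+(x, y). ennreal (dist x y powr p) \<partial>\<pi>)) powr (1 / p)"

definition gen_wasserstein ::
    "real \<Rightarrow> real \<Rightarrow> real \<Rightarrow> 'a::metric_space measure \<Rightarrow> 'a measure \<Rightarrow> real" where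
  "gen_wasserstein a b p \<mu>1 \<mu>2 =
     (Inf {a * total_variation (signed_diff \<mu>1 \<mu>1') + a * total_variation (signed_diff \<mu>2 \<mu>2')
             + b powr p * wasserstein p \<mu>1' \<mu>2' powr p | \<mu>1' \<mu>2'.
           \<mu>1' \<in> finite_moment_measures p \<and> \<mu>2' \<in> finite_moment_measures p \<and>
           measure \<mu>1' UNIV = measure \<mu>2' UNIV}) powr (1 / p)"


section \<open>Dual side\<close>

definition I_fun :: "real \<Rightarrow> real \<Rightarrow> ereal" where
  "I_fun a t = (INF s\<in>{0..}. ereal (s * t + a * \<bar>1 - s\<bar>))"

lemma I_fun_cases:
  assumes "a > 0"
  shows "I_fun a t = (if t > a then ereal a else if - a \<le> t then ereal t else - \<infinity>)"
proof -
  consider "t > a" | "- a \<le> t" "t \<le> a" | "t < - a" by linarith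
  then show ?thesis
  proof cases
    case 1
    have "I_fun a t = ereal a"
      unfolding I_fun_def
    proof (rule antisym)
      show "(INF s\<in>{0..}. ereal (s * t + a * \<bar>1 - s\<bar>)) \<le> ereal a"
        by (rule INF_lower2[of 0]) auto
      show "ereal a \<le> (INF s\<in>{0..}. ereal (s * t + a * \<bar>1 - s\<bar>))"
      proof (rule INF_greatest)
        fix s :: real assume "s \<in> {0..}"
        then have "a * s \<le> s * t" "a * (1 - s) \<le> a * \<bar>1 - s\<bar>"
          using 1 assms by (auto simp: mult.commute[of s t] intro!: mult_right_mono mult_left_mono)
        then show "ereal a \<le> ereal (s * t + a * \<bar>1 - s\<bar>)"
          by (simp add: algebra_simps)
      qed
    qed
    then show ?thesis using 1 by simp
  next
    case 2
    have "I_fun a t = ereal t"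
      unfolding I_fun_def
    proof (rule antisym)
      show "(INF s\<in>{0..}. ereal (s * t + a * \<bar>1 - s\<bar>)) \<le> ereal t"
        by (rule INF_lower2[of 1]) auto
      show "ereal t \<le> (INF s\<in>{0..}. ereal (s * t + a * \<bar>1 - s\<bar>))"
      proof (rule INF_greatest)
        fix s :: real
        have "(1 - s) * t \<le> \<bar>1 - s\<bar> * \<bar>t\<bar>" by (metis abs_ge_self abs_mult)
        also have "\<dots> \<le> \<bar>1 - s\<bar> * a" using 2 by (intro mult_left_mono) auto
        finally show "ereal t \<le> ereal (s * t + a * \<bar>1 - s\<bar>)"
          by (simp add: algebra_simps)
      qed
    qed
    then show ?thesis using 2 by auto
  next
    case 3
    have "I_fun a t \<le> ereal r" for r
    proof -
      define s where "s = max 1 ((r + a) / (t + a))"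
      have "s \<ge> 1" "(r + a) / (t + a) \<le> s" by (auto simp: s_def)
      then have "s * (t + a) \<le> r + a" using 3 by (simp add: neg_divide_le_eq)
      then have "s * t + a * \<bar>1 - s\<bar> \<le> r" using \<open>s \<ge> 1\<close> by (simp add: algebra_simps)
      then show ?thesis unfolding I_fun_def using \<open>s \<ge> 1\<close> by (intro INF_lower2[of s]) auto
    qed
    then have "I_fun a t = - \<infinity>" by (rule ereal_bot)
    then show ?thesis using 3 assms by auto
  qed
qed

definition Phi_W ::
    "real \<Rightarrow> real \<Rightarrow> real \<Rightarrow> (('a::metric_space \<Rightarrow>\<^sub>C real) \<times> ('a \<Rightarrow>\<^sub>C real)) set" where
  "Phi_W a b p = {(\<phi>1, \<phi>2). \<forall>x y.
     apply_bcontfun \<phi>1 x + apply_bcontfun \<phi>2 y \<le> (b * dist x y) powr p \<and>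
     apply_bcontfun \<phi>1 x \<ge> - a \<and> apply_bcontfun \<phi>2 y \<ge> - a}"

definition lip_norm :: "('a::metric_space \<Rightarrow> real) \<Rightarrow> ennreal" where
  "lip_norm f = (SUP (x, y)\<in>{(x, y). x \<noteq> y}. ennreal (\<bar>f x - f y\<bar> / dist x y))"

definition F_class :: "real \<Rightarrow> real \<Rightarrow> ('a::metric_space \<Rightarrow>\<^sub>C real) set" where
  "F_class a b = {f. norm f \<le> a \<and> lip_norm (apply_bcontfun f) \<le> ennreal b}"

text \<open>
  On \<^const>\<open>Phi_W\<close> the values of \<^const>\<open>I_fun\<close> are finite (see \<open>I_fun_cases\<close>), so that
  \<^const>\<open>real_of_ereal\<close> loses nothing.
\<close>

definition I_integral :: "real \<Rightarrow> 'a::topological_space measure \<Rightarrow> ('a \<Rightarrow>\<^sub>C real) \<Rightarrow> real" where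
  "I_integral a \<mu> \<phi> = (\<integral>x. real_of_ereal (I_fun a (apply_bcontfun \<phi> x)) \<partial>\<mu>)"

end

theory Submission
  imports Defs
begin

text \<open>
  Weak duality is a direct estimate. For the converse no compactness is needed, because the infimum
  and the supremum only have to be compared up to \<open>\<epsilon>\<close>. Up to small mass, \<open>X\<close> is a finite union of cells of small
  diameter. The discretised problem is a finite linear program, whose dual variables are bounded by
  \<open>a\<close>. An approximately optimal discrete plan is spread over products of cells with a density with
  respect to \<open>\<mu> \<otimes> \<nu>\<close>, so that its marginals are close to \<open>\<mu>\<close> and \<open>\<nu>\<close> in total variation, and the discrete potentials
  are extended to \<open>X\<close> by \<open>c\<close>-transforms. Since \<open>\<phi>1 + \<phi>2 \<le> 2 a\<close> may be assumed, the cost can be truncated above \<open>2 a\<close>, which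
  makes it uniformly continuous. For \<open>p = 1\<close> a pair of potentials is
  replaced by \<open>f\<close> and \<open>- f\<close>, where \<open>f\<close> is the \<open>c\<close>-transform of the second one.
\<close>

section \<open>Approximate duality for finite partial transport\<close>

text \<open>The bound \<open>a\<close> on the dual variables is conjugate to the mass penalty:
  \<open>a * \<bar>x\<bar>\<close> is the maximum of \<open>u * x\<close> over
  \<open>\<bar>u\<bar> \<le> a\<close>. For potentials, the lower half of this bound is a constraint
  in \<open>Phi_W\<close>, and the upper half is the effect of \<open>I_fun\<close>. Two obstacles
  shape the construction. Atoms at cell centres would in general be singular to \<mu> and \<nu>,
  hence far from them in total variation. A density that is constant on products of cells keeps the
  shape of \<mu> and \<nu> inside each cell, so the variation is at most the discrete mass defect
  plus the mass outside the cells. Such densities also have bounded support, hence finite p-moment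
  even when \<mu> and \<nu> have none. Moreover, for p > 1 the cost need not be uniformly continuous
  on an unbounded space, so no mesh size would control it. The truncated cost can be controlled, but
  it may replace the true one only where the plan has no mass above the cut. This is why the finite
  lemma also reports that \<open>\<pi> i j > 0\<close> forces \<open>c i j < 2 * a\<close>.\<close>

lemma finite_approx_duality:
  fixes c :: "'i \<Rightarrow> 'j \<Rightarrow> real"
  assumes fin: "finite I" "finite J" and a: "a > 0" and \<kappa>: "\<kappa> > 0"
    and m: "\<And>i. i \<in> I \<Longrightarrow> m i \<ge> 0" and k: "\<And>j. j \<in> J \<Longrightarrow> k j \<ge> 0"
    and c: "\<And>i j. i \<in> I \<Longrightarrow> j \<in> J \<Longrightarrow> c i j \<ge> 0"
  obtains u v \<pi> where
    "\<And>i. i \<in> I \<Longrightarrow> \<bar>u i\<bar> \<le> a" "\<And>j. j \<in> J \<Longrightarrow> \<bar>v j\<bar> \<le> a"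
    "\<And>i j. i \<in> I \<Longrightarrow> j \<in> J \<Longrightarrow> u i + v j \<le> c i j + \<kappa>"
    "\<And>i j. \<pi> i j \<ge> 0"
    "\<And>i j. i \<in> I \<Longrightarrow> j \<in> J \<Longrightarrow> \<pi> i j > 0 \<Longrightarrow> c i j < 2 * a"
    "a * (\<Sum>i\<in>I. \<bar>m i - (\<Sum>j\<in>J. \<pi> i j)\<bar>) + a * (\<Sum>j\<in>J. \<bar>k j - (\<Sum>i\<in>I. \<pi> i j)\<bar>)
       + (\<Sum>i\<in>I. \<Sum>j\<in>J. c i j * \<pi> i j)
     \<le> (\<Sum>i\<in>I. u i * m i) + (\<Sum>j\<in>J. v j * k j) + \<kappa>"
proof -
  \<comment> \<open>Take a near-maximiser \<open>(u, v)\<close> of the dual functional with the constraint replaced by the penalty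
    \<open>(u i + v j - c i j)\<^sub>+\<^sup>2 / (2 \<epsilon>)\<close>. The derivative of the penalty is the plan, and comparing with a small
    step towards \<open>a * sgn\<close> of the mass defects yields the approximate complementary slackness.\<close>
  define K where "K = a * ((\<Sum>i\<in>I. m i) + (\<Sum>j\<in>J. k j)) + 1"
  have "0 \<le> (\<Sum>i\<in>I. m i) + (\<Sum>j\<in>J. k j)" by (intro add_nonneg_nonneg sum_nonneg m k)
  then have K: "K > 0" using a by (simp add: K_def add_nonneg_pos)
  \<comment> \<open>\<open>K - 1\<close> bounds the linear part of \<open>D\<close> on the box
    \<open>B\<close>. A pair with \<open>D\<close> at least -1 therefore has penalty at most
    \<open>K\<close>, and \<open>2 * \<epsilon> * K = \<kappa>\<^sup>2\<close> turns this into a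
    violation of at most \<kappa> in every single constraint.\<close>
  define \<epsilon> where "\<epsilon> = \<kappa>\<^sup>2 / (2 * K)"
  have \<epsilon>: "\<epsilon> > 0" using K \<kappa> by (simp add: \<epsilon>_def)
  \<comment> \<open>A step of length \<open>t\<close> costs at most \<open>t\<^sup>2 * C\<close> at
    second order, since each increment \<open>s i + r j\<close> is at most \<open>4 * a\<close> in
    modulus. The choice of \<open>t\<close> makes this cost, and the choice of \<eta> makes the
    slack of near-maximality, at most half of \<open>t * \<kappa>\<close>.\<close>
  define C where "C = (16 * a\<^sup>2 * (card I * card J)) / (2 * \<epsilon>)"
  have C: "C \<ge> 0" using \<epsilon> by (simp add: C_def)
  define t where "t = min 1 (\<kappa> / (2 * (C + 1)))"
  have t: "0 < t" "t \<le> 1" "t * C \<le> \<kappa> / 2"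
  proof -
    show "0 < t" "t \<le> 1" using \<kappa> C by (auto simp: t_def)
    have "t * C \<le> \<kappa> / (2 * (C + 1)) * (C + 1)" using \<kappa> C by (intro mult_mono) (auto simp: t_def)
    also have "\<dots> = \<kappa> / 2" using C by (simp add: divide_simps)
    finally show "t * C \<le> \<kappa> / 2" .
  qed
  define \<eta> where "\<eta> = min 1 (t * \<kappa> / 2)"
  have \<eta>: "\<eta> > 0" "\<eta> \<le> 1" "\<eta> \<le> t * \<kappa> / 2" using t \<kappa> by (auto simp: \<eta>_def)
  define w where "w = (\<lambda>u v i j. max 0 (u i + v j - c i j))"
  define D where "D = (\<lambda>(u, v). (\<Sum>i\<in>I. u i * m i) + (\<Sum>j\<in>J. v j * k j)
      - (\<Sum>i\<in>I. \<Sum>j\<in>J. (w u v i j)\<^sup>2) / (2 * \<epsilon>))"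
  define B where "B = {(u, v). (\<forall>i\<in>I. \<bar>u i\<bar> \<le> a) \<and> (\<forall>j\<in>J. \<bar>v j\<bar> \<le> a)}"
  have lin: "(\<Sum>i\<in>I. u i * m i) + (\<Sum>j\<in>J. v j * k j) \<le> K - 1" if "(u, v) \<in> B" for u v
  proof -
    have "(\<Sum>i\<in>I. u i * m i) \<le> (\<Sum>i\<in>I. a * m i)"
      using that m by (intro sum_mono mult_right_mono) (auto simp: B_def abs_le_iff)
    moreover have "(\<Sum>j\<in>J. v j * k j) \<le> (\<Sum>j\<in>J. a * k j)"
      using that k by (intro sum_mono mult_right_mono) (auto simp: B_def abs_le_iff)
    ultimately show ?thesis by (simp add: K_def sum_distrib_left distrib_left)
  qed
  have pen: "(\<Sum>i\<in>I. \<Sum>j\<in>J. (w u v i j)\<^sup>2) \<ge> 0" for u v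
    by (intro sum_nonneg) auto
  have DK: "D z \<le> K" if "z \<in> B" for z
  proof -
    obtain u v where z: "z = (u, v)" by fastforce
    have "(\<Sum>i\<in>I. \<Sum>j\<in>J. (w u v i j)\<^sup>2) / (2 * \<epsilon>) \<ge> 0" using pen \<epsilon> by simp
    then show ?thesis using lin[of u v] that unfolding z D_def by simp
  qed
  have bdd: "bdd_above (D ` B)" using DK by (auto intro!: bdd_aboveI2)
  have 0: "((\<lambda>_. 0), (\<lambda>_. 0)) \<in> B" using a by (auto simp: B_def)
  have "w (\<lambda>_. 0) (\<lambda>_. 0) i j = 0" if "i \<in> I" "j \<in> J" for i j using c[OF that] by (auto simp: w_def)
  then have "D ((\<lambda>_. 0), (\<lambda>_. 0)) = 0" by (simp add: D_def)
  then have S0: "0 \<le> Sup (D ` B)" using cSUP_upper[OF 0 bdd] by simp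
  have "Sup (D ` B) - \<eta> < Sup (D ` B)" using \<eta> by simp
  then obtain z where z: "z \<in> B" "Sup (D ` B) - \<eta> < D z"
    using less_cSUP_iff[of B D] 0 bdd by (metis empty_iff)
  obtain u v where uv: "z = (u, v)" by fastforce
  have u: "\<And>i. i \<in> I \<Longrightarrow> \<bar>u i\<bar> \<le> a" and v: "\<And>j. j \<in> J \<Longrightarrow> \<bar>v j\<bar> \<le> a"
    using z uv by (auto simp: B_def)
  define \<pi> where "\<pi> = (\<lambda>i j. w u v i j / \<epsilon>)"
  define P where "P = (\<lambda>i. m i - (\<Sum>j\<in>J. \<pi> i j))"
  define Q where "Q = (\<lambda>j. k j - (\<Sum>i\<in>I. \<pi> i j))"
  define s where "s = (\<lambda>i. a * sgn (P i) - u i)"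
  define r where "r = (\<lambda>j. a * sgn (Q j) - v j)"
  have sgn: "\<bar>a * sgn x\<bar> \<le> a" for x :: real using a by (auto simp: sgn_if)
  have s: "\<bar>s i\<bar> \<le> 2 * a" if "i \<in> I" for i using u[OF that] sgn[of "P i"] unfolding s_def by linarith
  have r: "\<bar>r j\<bar> \<le> 2 * a" if "j \<in> J" for j using v[OF that] sgn[of "Q j"] unfolding r_def by linarith
  define u' where "u' = (\<lambda>i. u i + t * s i)"
  define v' where "v' = (\<lambda>j. v j + t * r j)"
  have convex: "\<bar>x + t * (y - x)\<bar> \<le> a" if "\<bar>x\<bar> \<le> a" "\<bar>y\<bar> \<le> a" for x y
  proof -
    have "x + t * (y - x) = (1 - t) * x + t * y" by (simp add: algebra_simps)
    also have "\<bar>\<dots>\<bar> \<le> (1 - t) * \<bar>x\<bar> + t * \<bar>y\<bar>"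
      using abs_triangle_ineq[of "(1 - t) * x" "t * y"] t by (simp add: abs_mult)
    also have "\<dots> \<le> (1 - t) * a + t * a" using t that by (intro add_mono mult_left_mono) auto
    finally show ?thesis by (simp add: algebra_simps)
  qed
  have "(u', v') \<in> B" by (simp add: B_def u'_def v'_def s_def r_def u v sgn convex)
  then have "D (u', v') \<le> Sup (D ` B)" using bdd by (intro cSUP_upper)
  then have D': "D (u', v') \<le> D (u, v) + \<eta>" using z uv by simp
  \<comment> \<open>Second-order bound for the squared positive part: its derivative
    \<open>2 * max 0 x\<close> is what produces \<pi>, and the remainder \<open>h\<^sup>2\<close> is
    what \<open>C\<close> collects.\<close>
  have sq: "(max 0 (x + h))\<^sup>2 \<le> (max 0 x)\<^sup>2 + 2 * max 0 x * h + h\<^sup>2" for x h :: real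
  proof -
    have "(max 0 (x + h))\<^sup>2 \<le> (max 0 x + h)\<^sup>2"
    proof (cases "x + h \<ge> 0")
      case True then show ?thesis by (intro power_mono) auto
    qed auto
    then show ?thesis by (simp add: power2_sum)
  qed
  have "(w u' v' i j)\<^sup>2 \<le> (w u v i j)\<^sup>2 + 2 * t * \<epsilon> * (\<pi> i j * s i + \<pi> i j * r j) + t\<^sup>2 * (16 * a\<^sup>2)"
    if "i \<in> I" "j \<in> J" for i j
  proof -
    have "w u' v' i j = max 0 ((u i + v j - c i j) + t * (s i + r j))"
      by (simp add: w_def u'_def v'_def algebra_simps)
    then have "(w u' v' i j)\<^sup>2 \<le> (w u v i j)\<^sup>2 + 2 * w u v i j * (t * (s i + r j)) + (t * (s i + r j))\<^sup>2"
      using sq[of "u i + v j - c i j" "t * (s i + r j)"] by (simp add: w_def)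
    moreover have "(s i + r j)\<^sup>2 \<le> (4 * a)\<^sup>2"
      using s[OF that(1)] r[OF that(2)] a by (intro abs_le_square_iff[THEN iffD1]) auto
    then have "(t * (s i + r j))\<^sup>2 \<le> t\<^sup>2 * (16 * a\<^sup>2)"
      by (simp add: power_mult_distrib mult_left_mono)
    moreover have "2 * t * \<epsilon> * (\<pi> i j * s i + \<pi> i j * r j) = 2 * w u v i j * (t * (s i + r j))"
      using \<epsilon> by (simp add: \<pi>_def field_simps)
    ultimately show ?thesis by linarith
  qed
  then have "(\<Sum>i\<in>I. \<Sum>j\<in>J. (w u' v' i j)\<^sup>2) \<le> (\<Sum>i\<in>I. \<Sum>j\<in>J. (w u v i j)\<^sup>2
      + 2 * t * \<epsilon> * (\<pi> i j * s i + \<pi> i j * r j) + t\<^sup>2 * (16 * a\<^sup>2))"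
    by (intro sum_mono) auto
  also have "\<dots> = (\<Sum>i\<in>I. \<Sum>j\<in>J. (w u v i j)\<^sup>2) + 2 * \<epsilon> * (t *
      ((\<Sum>i\<in>I. \<Sum>j\<in>J. \<pi> i j * s i) + (\<Sum>i\<in>I. \<Sum>j\<in>J. \<pi> i j * r j)) + t\<^sup>2 * C)"
    using \<epsilon> by (simp add: sum.distrib sum_distrib_left C_def field_simps)
  also have "(\<Sum>i\<in>I. \<Sum>j\<in>J. \<pi> i j * r j) = (\<Sum>j\<in>J. \<Sum>i\<in>I. \<pi> i j * r j)" by (rule sum.swap)
  finally have "(\<Sum>i\<in>I. \<Sum>j\<in>J. (w u' v' i j)\<^sup>2) / (2 * \<epsilon>) \<le> (\<Sum>i\<in>I. \<Sum>j\<in>J. (w u v i j)\<^sup>2) / (2 * \<epsilon>)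
      + (t * ((\<Sum>i\<in>I. \<Sum>j\<in>J. \<pi> i j * s i) + (\<Sum>j\<in>J. \<Sum>i\<in>I. \<pi> i j * r j)) + t\<^sup>2 * C)"
    using \<epsilon> by (simp add: field_simps)
  with D' have "t * ((\<Sum>i\<in>I. s i * m i) + (\<Sum>j\<in>J. r j * k j))
      \<le> t * ((\<Sum>i\<in>I. \<Sum>j\<in>J. \<pi> i j * s i) + (\<Sum>j\<in>J. \<Sum>i\<in>I. \<pi> i j * r j)) + t\<^sup>2 * C + \<eta>"
    by (simp add: D_def u'_def v'_def algebra_simps sum.distrib sum_distrib_left)
  then have "t * ((\<Sum>i\<in>I. s i * P i) + (\<Sum>j\<in>J. r j * Q j)) \<le> t\<^sup>2 * C + \<eta>"
    by (simp add: P_def Q_def algebra_simps sum_subtractf sum_distrib_left)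
  also have "\<dots> \<le> t * (t * C) + t * \<kappa> / 2" using \<eta> by (simp add: power2_eq_square)
  also have "t * (t * C) \<le> t * (\<kappa> / 2)" using t by (intro mult_left_mono) auto
  also have "t * (\<kappa> / 2) + t * \<kappa> / 2 = t * \<kappa>" by simp
  finally have A: "(\<Sum>i\<in>I. s i * P i) + (\<Sum>j\<in>J. r j * Q j) \<le> \<kappa>" using t by simp
  have sgn_mult: "sgn x * x = \<bar>x\<bar>" for x :: real by (simp add: sgn_if)
  have "s i * P i = a * \<bar>P i\<bar> - u i * P i" for i by (simp add: s_def left_diff_distrib mult.assoc sgn_mult)
  moreover have "r j * Q j = a * \<bar>Q j\<bar> - v j * Q j" for j by (simp add: r_def left_diff_distrib mult.assoc sgn_mult)
  ultimately have A': "a * (\<Sum>i\<in>I. \<bar>P i\<bar>) + a * (\<Sum>j\<in>J. \<bar>Q j\<bar>)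
      \<le> (\<Sum>i\<in>I. u i * P i) + (\<Sum>j\<in>J. v j * Q j) + \<kappa>"
    using A by (simp add: sum_subtractf sum_distrib_left)
  \<comment> \<open>Approximate complementary slackness: \<pi> charges only pairs where the
    constraint is violated, and there the cost is below \<open>u i + v j\<close>. Adding this to
    \<open>A'\<close> recombines the defects \<open>P\<close>, \<open>Q\<close> and the marginals of
    \<pi> into \<open>m\<close> and \<open>k\<close>.\<close>
  have "(\<Sum>i\<in>I. \<Sum>j\<in>J. c i j * \<pi> i j) \<le> (\<Sum>i\<in>I. \<Sum>j\<in>J. u i * \<pi> i j + v j * \<pi> i j)"
  proof (intro sum_mono)
    fix i j
    have "0 \<le> (u i + v j - c i j) * w u v i j" by (auto simp: w_def max_def)
    then show "c i j * \<pi> i j \<le> u i * \<pi> i j + v j * \<pi> i j"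
      using \<epsilon> by (simp add: \<pi>_def field_simps)
  qed
  also have "\<dots> = (\<Sum>i\<in>I. u i * (\<Sum>j\<in>J. \<pi> i j)) + (\<Sum>j\<in>J. v j * (\<Sum>i\<in>I. \<pi> i j))"
    using sum.swap[of "\<lambda>i j. v j * \<pi> i j" J I] by (simp add: sum.distrib sum_distrib_left)
  finally have A'': "a * (\<Sum>i\<in>I. \<bar>P i\<bar>) + a * (\<Sum>j\<in>J. \<bar>Q j\<bar>) + (\<Sum>i\<in>I. \<Sum>j\<in>J. c i j * \<pi> i j)
      \<le> (\<Sum>i\<in>I. u i * m i) + (\<Sum>j\<in>J. v j * k j) + \<kappa>"
    using A' by (simp add: P_def Q_def algebra_simps sum_subtractf)
  have viol: "u i + v j \<le> c i j + \<kappa>" if ij: "i \<in> I" "j \<in> J" for i j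
  proof -
    have "(w u v i j)\<^sup>2 \<le> (\<Sum>j\<in>J. (w u v i j)\<^sup>2)"
      by (rule member_le_sum[where f="\<lambda>j. (w u v i j)\<^sup>2" and i=j]) (use fin ij in simp_all)
    also have "\<dots> \<le> (\<Sum>i\<in>I. \<Sum>j\<in>J. (w u v i j)\<^sup>2)"
      by (rule member_le_sum[where f="\<lambda>i. \<Sum>j\<in>J. (w u v i j)\<^sup>2" and i=i])
        (use fin ij in \<open>simp_all add: sum_nonneg\<close>)
    finally have *: "(w u v i j)\<^sup>2 \<le> (\<Sum>i\<in>I. \<Sum>j\<in>J. (w u v i j)\<^sup>2)" .
    have "- 1 \<le> D (u, v)" using z(2) S0 \<eta>(2) unfolding uv by linarith
    then have "(\<Sum>i\<in>I. \<Sum>j\<in>J. (w u v i j)\<^sup>2) / (2 * \<epsilon>) \<le> K"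
      using lin[of u v] z(1) unfolding uv D_def by simp
    then have "(\<Sum>i\<in>I. \<Sum>j\<in>J. (w u v i j)\<^sup>2) \<le> K * (2 * \<epsilon>)" using \<epsilon> by (simp add: field_simps)
    also have "\<dots> = \<kappa>\<^sup>2" using K by (simp add: \<epsilon>_def)
    finally have "(w u v i j)\<^sup>2 \<le> \<kappa>\<^sup>2" by (rule order_trans[OF *])
    then have "w u v i j \<le> \<kappa>" using less_imp_le[OF \<kappa>] by (rule power2_le_imp_le)
    then show ?thesis by (simp add: w_def)
  qed
  have supp: "c i j < 2 * a" if "i \<in> I" "j \<in> J" "\<pi> i j > 0" for i j
  proof -
    have "w u v i j > 0" using that \<epsilon> by (simp add: \<pi>_def zero_less_divide_iff)
    then have "c i j < u i + v j" by (simp add: w_def)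
    then show ?thesis using u[OF that(1)] v[OF that(2)] by linarith
  qed
  have \<pi>0: "\<pi> i j \<ge> 0" for i j using \<epsilon> by (simp add: \<pi>_def w_def)
  show thesis
    using that[of u v \<pi>] u v viol \<pi>0 supp A''[unfolded P_def Q_def] by blast
qed

section \<open>Total variation and signed integrals\<close>

text \<open>An identity between two differences of measures, rearranged into sums so that it makes
  sense for extended nonnegative values, passes from sets to functions. It serves to compare a
  Jordan decomposition with the difference it comes from.\<close>

lemma nn_integral_add_measures_cong:
  assumes [measurable_cong]: "sets M2 = sets M1" "sets M3 = sets M1" "sets M4 = sets M1"
    and eq: "\<And>A. A \<in> sets M1 \<Longrightarrow> emeasure M1 A + emeasure M2 A = emeasure M3 A + emeasure M4 A"
    and "f \<in> borel_measurable M1"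
  shows "integral\<^sup>N M1 f + integral\<^sup>N M2 f = integral\<^sup>N M3 f + integral\<^sup>N M4 f"
  using assms(5)
proof (induction rule: borel_measurable_induct)
  case (cong f g)
  have "space M2 = space M1" "space M3 = space M1" "space M4 = space M1"
    using assms(1-3) by (auto dest: sets_eq_imp_space_eq)
  then have "integral\<^sup>N M f = integral\<^sup>N M g" if "M \<in> {M1, M2, M3, M4}" for M
    using cong(3) that by (intro nn_integral_cong) auto
  then show ?case using cong by simp
next
  case (set A)
  then show ?case using assms(1-3) eq by simp
next
  case (mult u c)
  note [measurable] = \<open>u \<in> borel_measurable M1\<close>
  show ?case using mult by (simp add: nn_integral_cmult flip: distrib_left)
next
  case (add u v)
  note [measurable] = \<open>u \<in> borel_measurable M1\<close> \<open>v \<in> borel_measurable M1\<close>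
  have "integral\<^sup>N M (\<lambda>x. v x + u x) = integral\<^sup>N M v + integral\<^sup>N M u" if "sets M = sets M1" for M
  proof -
    note [measurable_cong] = that
    show ?thesis by (intro nn_integral_add) auto
  qed
  note * = this[OF refl] this[OF assms(1)] this[OF assms(2)] this[OF assms(3)]
  have "(v1 + u1) + (v2 + u2) = (v3 + u3) + (v4 + u4)"
    if "u1 + u2 = u3 + u4" "v1 + v2 = v3 + v4" for u1 u2 u3 u4 v1 v2 v3 v4 :: ennreal
  proof -
    have "(v1 + u1) + (v2 + u2) = (v1 + v2) + (u1 + u2)" by (simp only: ac_simps)
    also have "\<dots> = (v3 + v4) + (u3 + u4)" by (simp only: that)
    also have "\<dots> = (v3 + u3) + (v4 + u4)" by (simp only: ac_simps)
    finally show ?thesis .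
  qed
  from this[OF add.IH] show ?case unfolding * .
next
  case (seq U)
  note [measurable] = seq(1)
  have *: "integral\<^sup>N M (Sup (range U)) = (SUP i. integral\<^sup>N M (U i))" and
    inc: "incseq (\<lambda>i. integral\<^sup>N M (U i))" if "sets M = sets M1" for M
  proof -
    note [measurable_cong] = that
    have "integral\<^sup>N M (Sup (range U)) = (\<integral>\<^sup>+x. (SUP i. U i x) \<partial>M)" 
      by (intro nn_integral_cong) (auto simp: image_comp SUP_apply[abs_def])
    also have "\<dots> = (SUP i. integral\<^sup>N M (U i))"
      using seq(3) by (intro nn_integral_monotone_convergence_SUP) auto
    finally show "integral\<^sup>N M (Sup (range U)) = (SUP i. integral\<^sup>N M (U i))" .
    show "incseq (\<lambda>i. integral\<^sup>N M (U i))"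
      using seq(3) by (auto simp: incseq_def le_fun_def intro!: nn_integral_mono)
  qed
  show ?case
    unfolding *[OF refl] *[OF assms(1)] *[OF assms(2)] *[OF assms(3)]
    using assms(1-3) seq.IH by (simp add: inc flip: ennreal_SUP_add)
qed

lemma finite_borel_measuresD:
  assumes "\<mu> \<in> finite_borel_measures"
  shows "finite_measure \<mu>" "sets \<mu> = sets borel" "space \<mu> = UNIV"
  using assms sets_eq_imp_space_eq[of \<mu> borel] by (auto simp: finite_borel_measures_def)

lemma integrable_bounded_borel:
  fixes f :: "'a::topological_space \<Rightarrow> real"
  assumes "\<mu> \<in> finite_borel_measures" "f \<in> borel_measurable borel" "\<And>x. \<bar>f x\<bar> \<le> a"
  shows "integrable \<mu> f"
proof -
  note [measurable_cong] = finite_borel_measuresD(2)[OF assms(1)]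
  show ?thesis
    using assms by (intro finite_measure.integrable_const_bound[OF finite_borel_measuresD(1), of _ _ a]) auto
qed

lemma jordan_decomposition_signed_diff_cases:
  assumes "\<mu> \<in> finite_borel_measures" "\<nu> \<in> finite_borel_measures"
  obtains P N S where "jordan_decomposition (signed_diff \<mu> \<nu>) = (P, N)"
    "P \<in> finite_borel_measures" "N \<in> finite_borel_measures"
    "S \<in> sets borel" "emeasure P (- S) = 0" "emeasure N S = 0"
    "\<And>A. A \<in> sets borel \<Longrightarrow> measure \<mu> A - measure \<nu> A = measure P A - measure N A"
proof -
  obtain P N where "jordan_decomposition (signed_diff \<mu> \<nu>) = (P, N)" by fastforce
  with is_jordan_decomposition_jordan_decomposition[OF assms] that show ?thesis
    by (auto simp: is_jordan_decomposition_def signed_diff_def)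
qed

lemma signed_integral_signed_diff:
  fixes f :: "'a::topological_space \<Rightarrow> real"
  assumes \<mu>: "\<mu> \<in> finite_borel_measures" and \<nu>: "\<nu> \<in> finite_borel_measures"
    and f: "f \<in> borel_measurable borel" "\<And>x. \<bar>f x\<bar> \<le> a"
  shows "signed_integral (signed_diff \<mu> \<nu>) f = (\<integral>x. f x \<partial>\<mu>) - (\<integral>x. f x \<partial>\<nu>)"
proof -
  obtain P N S where J: "jordan_decomposition (signed_diff \<mu> \<nu>) = (P, N)"
    and P: "P \<in> finite_borel_measures" and N: "N \<in> finite_borel_measures"
    and eq: "\<And>A. A \<in> sets borel \<Longrightarrow> measure \<mu> A - measure \<nu> A = measure P A - measure N A"
    using jordan_decomposition_signed_diff_cases[OF \<mu> \<nu>] by metis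
  have e: "emeasure \<mu> A + emeasure N A = emeasure \<nu> A + emeasure P A" if "A \<in> sets borel" for A
    using eq[OF that] \<mu> \<nu> P N
    by (simp add: finite_measure.emeasure_eq_measure finite_borel_measuresD flip: ennreal_plus)
  have s: "sets \<mu> = sets borel" "sets \<nu> = sets borel" "sets P = sets borel" "sets N = sets borel"
    using \<mu> \<nu> P N finite_borel_measuresD by auto
  \<comment> \<open>Adding the constant \<open>a\<close> makes the integrand nonnegative. The
    contribution of this constant cancels at the end because the four total masses satisfy the same
    relation.\<close>
  have nn: "integral\<^sup>N \<mu> (\<lambda>x. ennreal (f x + a)) + integral\<^sup>N N (\<lambda>x. ennreal (f x + a))
      = integral\<^sup>N \<nu> (\<lambda>x. ennreal (f x + a)) + integral\<^sup>N P (\<lambda>x. ennreal (f x + a))"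
    using s e f(1) by (intro nn_integral_add_measures_cong) (auto cong: measurable_cong_sets)
  have pos: "0 \<le> f x + a" for x using f(2)[of x] by linarith
  have "integral\<^sup>N M (\<lambda>x. ennreal (f x + a)) = ennreal ((\<integral>x. f x \<partial>M) + a * measure M UNIV)"
    and "(\<integral>x. f x \<partial>M) + a * measure M UNIV \<ge> 0"
    if M: "M \<in> finite_borel_measures" for M
  proof -
    interpret finite_measure M using finite_borel_measuresD(1)[OF M] .
    have i: "integrable M f" by (rule integrable_bounded_borel[OF M f])
    have *: "(\<integral>x. f x + a \<partial>M) = (\<integral>x. f x \<partial>M) + a * measure M UNIV"
      using i by (subst Bochner_Integration.integral_add) (auto simp: finite_borel_measuresD[OF M])
    show "(\<integral>x. f x \<partial>M) + a * measure M UNIV \<ge> 0"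
      unfolding *[symmetric] using pos by simp
    show "integral\<^sup>N M (\<lambda>x. ennreal (f x + a)) = ennreal ((\<integral>x. f x \<partial>M) + a * measure M UNIV)"
      unfolding *[symmetric] using i pos by (intro nn_integral_eq_integral) auto
  qed
  note * = this[OF \<mu>] this[OF \<nu>] this[OF P] this[OF N]
  have "(\<integral>x. f x \<partial>\<mu>) + a * measure \<mu> UNIV + ((\<integral>x. f x \<partial>N) + a * measure N UNIV)
      = (\<integral>x. f x \<partial>\<nu>) + a * measure \<nu> UNIV + ((\<integral>x. f x \<partial>P) + a * measure P UNIV)"
    using nn unfolding * by (simp only: ennreal_plus[symmetric] * ennreal_inj add_nonneg_nonneg)
  moreover have "measure \<mu> UNIV + measure N UNIV = measure \<nu> UNIV + measure P UNIV"
    using eq[of UNIV] by simp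
  then have "a * measure \<mu> UNIV + a * measure N UNIV = a * measure \<nu> UNIV + a * measure P UNIV"
    by (simp flip: distrib_left)
  ultimately show ?thesis by (simp add: signed_integral_def J)
qed

text \<open>The easy half of the duality between total variation and functions bounded by
  \<open>a\<close>. In weak duality it lets the penalty pay for replacing \<mu> by another
  measure.\<close>

lemma integral_diff_le_total_variation:
  fixes f :: "'a::topological_space \<Rightarrow> real"
  assumes \<mu>: "\<mu> \<in> finite_borel_measures" and \<nu>: "\<nu> \<in> finite_borel_measures"
    and f: "f \<in> borel_measurable borel" "\<And>x. \<bar>f x\<bar> \<le> a"
  shows "(\<integral>x. f x \<partial>\<mu>) - (\<integral>x. f x \<partial>\<nu>) \<le> a * total_variation (signed_diff \<mu> \<nu>)"
proof -
  obtain P N where J: "jordan_decomposition (signed_diff \<mu> \<nu>) = (P, N)"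
    and P: "P \<in> finite_borel_measures" and N: "N \<in> finite_borel_measures"
    using jordan_decomposition_signed_diff_cases[OF \<mu> \<nu>] by metis
  have *: "\<bar>\<integral>x. f x \<partial>M\<bar> \<le> a * measure M UNIV" if M: "M \<in> finite_borel_measures" for M
  proof -
    interpret finite_measure M using finite_borel_measuresD(1)[OF M] .
    have i: "integrable M f" by (rule integrable_bounded_borel[OF M f])
    have "\<bar>\<integral>x. f x \<partial>M\<bar> \<le> (\<integral>x. \<bar>f x\<bar> \<partial>M)" by (rule integral_abs_bound)
    also have "\<dots> \<le> (\<integral>x. a \<partial>M)" using i f by (intro integral_mono) auto
    finally show ?thesis by (simp add: finite_borel_measuresD[OF M] mult.commute)
  qed
  show ?thesis
    using *[OF P] *[OF N] signed_integral_signed_diff[OF \<mu> \<nu> f]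
    by (simp add: signed_integral_def total_variation_def J distrib_left)
qed

lemma total_variation_nonneg:
  assumes "\<mu> \<in> finite_borel_measures" "\<nu> \<in> finite_borel_measures"
  shows "total_variation (signed_diff \<mu> \<nu>) \<ge> 0"
  using integral_diff_le_total_variation[OF assms, of "\<lambda>_. 0" 1] by simp

text \<open>\<open>P\<close> lives on the Hahn set \<open>S\<close> and \<open>N\<close> on its
  complement, so the variation is the value of the signed measure on \<open>S\<close> minus its
  value on \<open>- S\<close>. This is the integral of \<open>1 - g x\<close> with sign + on
  \<open>S\<close> and - off \<open>S\<close>, which \<open>\<bar>1 - g x\<bar>\<close>
  dominates.\<close>

lemma total_variation_density_le:
  fixes g :: "'a::topological_space \<Rightarrow> real"
  assumes \<mu>: "\<mu> \<in> finite_borel_measures"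
    and g: "g \<in> borel_measurable borel" "\<And>x. 0 \<le> g x" "\<And>x. g x \<le> K"
  shows "density \<mu> g \<in> finite_borel_measures"
    and "total_variation (signed_diff \<mu> (density \<mu> g)) \<le> (\<integral>x. \<bar>1 - g x\<bar> \<partial>\<mu>)"
proof -
  interpret finite_measure \<mu> using finite_borel_measuresD(1)[OF \<mu>] .
  note s[measurable_cong] = finite_borel_measuresD(2)[OF \<mu>] and sp = finite_borel_measuresD(3)[OF \<mu>]
  note [measurable] = g(1)
  have i: "integrable \<mu> g" using g by (intro integrable_bounded_borel[OF \<mu>, of _ K]) auto
  have m: "measure (density \<mu> g) A = (\<integral>x. indicator A x * g x \<partial>\<mu>)"
    and e: "emeasure (density \<mu> g) A = ennreal (\<integral>x. indicator A x * g x \<partial>\<mu>)" if "A \<in> sets borel" for A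
  proof -
    note [measurable] = that
    have "emeasure (density \<mu> g) A = (\<integral>\<^sup>+x. ennreal (indicator A x * g x) \<partial>\<mu>)"
      by (subst emeasure_density) (auto intro!: nn_integral_cong split: split_indicator)
    also have "\<dots> = ennreal (\<integral>x. indicator A x * g x \<partial>\<mu>)"
      using g i by (intro nn_integral_eq_integral)
       (auto intro!: integrable_bounded_borel[OF \<mu>, of _ "\<bar>K\<bar>"] split: split_indicator intro: order_trans[OF g(3) abs_ge_self])
    finally show *: "emeasure (density \<mu> g) A = ennreal (\<integral>x. indicator A x * g x \<partial>\<mu>)" .
    show "measure (density \<mu> g) A = (\<integral>x. indicator A x * g x \<partial>\<mu>)"
      unfolding measure_def * using g by simp
  qed
  show fb: "density \<mu> g \<in> finite_borel_measures"
    using e[of UNIV] s sp by (auto simp: finite_borel_measures_def intro!: finite_measureI)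
  obtain P N S where J: "jordan_decomposition (signed_diff \<mu> (density \<mu> g)) = (P, N)"
    and P: "P \<in> finite_borel_measures" and N: "N \<in> finite_borel_measures"
    and S: "S \<in> sets borel" "emeasure P (- S) = 0" "emeasure N S = 0"
    and eq: "\<And>A. A \<in> sets borel \<Longrightarrow> measure \<mu> A - measure (density \<mu> g) A = measure P A - measure N A"
    using jordan_decomposition_signed_diff_cases[OF \<mu> fb] by metis
  note [measurable] = S(1)
  have cS[measurable]: "- S \<in> sets borel" using S(1) by auto
  have d: "measure M UNIV = measure M S + measure M (- S)" if "M \<in> finite_borel_measures" for M
    using finite_measure.finite_measure_Union[OF finite_borel_measuresD(1)[OF that], of S "- S"] S(1) cS
      finite_borel_measuresD(2)[OF that] by (simp add: Compl_partition)
  have int: "integrable \<mu> (\<lambda>x. indicator A x * h x)"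
    if "h \<in> borel_measurable borel" "\<And>x. \<bar>h x\<bar> \<le> C" "A \<in> sets borel" for A and h :: "'a \<Rightarrow> real" and C
  proof -
    note [measurable] = that(1,3)
    show ?thesis
      by (intro integrable_bounded_borel[OF \<mu>, of _ "\<bar>C\<bar>"])
        (auto split: split_indicator intro: order_trans[OF that(2) abs_ge_self])
  qed
  have ms: "measure \<mu> A - measure (density \<mu> g) A = (\<integral>x. indicator A x * (1 - g x) \<partial>\<mu>)"
    if "A \<in> sets borel" for A
  proof -
    have "(\<integral>x. indicator A x * (1 - g x) \<partial>\<mu>) = (\<integral>x. indicator A x * 1 - indicator A x * g x \<partial>\<mu>)"
      by (simp add: right_diff_distrib)
    also have "\<dots> = (\<integral>x. indicator A x * 1 \<partial>\<mu>) - (\<integral>x. indicator A x * g x \<partial>\<mu>)"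
      using g that by (intro Bochner_Integration.integral_diff int[of _ K] int[of _ 1]) auto
    finally show ?thesis using m[OF that] that s sp by simp
  qed
  have bd: "\<bar>1 - g x\<bar> \<le> 1 + K" for x using g(2,3)[of x] by (auto simp: abs_le_iff)
  have "total_variation (signed_diff \<mu> (density \<mu> g)) = measure P S + measure N (- S)"
    using d[OF P] d[OF N] S by (simp add: total_variation_def J measure_def)
  also have "\<dots> = (measure P S - measure N S) - (measure P (- S) - measure N (- S))"
    using S by (simp add: measure_def)
  also have "\<dots> = (\<integral>x. indicator S x * (1 - g x) \<partial>\<mu>) - (\<integral>x. indicator (- S) x * (1 - g x) \<partial>\<mu>)"
    using eq[OF S(1)] eq[OF cS] ms[OF S(1)] ms[OF cS] by simp
  also have "\<dots> = (\<integral>x. indicator S x * (1 - g x) - indicator (- S) x * (1 - g x) \<partial>\<mu>)"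
    using bd by (intro Bochner_Integration.integral_diff[symmetric] int[of _ "1 + K"]) auto
  also have "\<dots> \<le> (\<integral>x. \<bar>1 - g x\<bar> \<partial>\<mu>)"
  proof (intro integral_mono)
    show "integrable \<mu> (\<lambda>x. indicator S x * (1 - g x) - indicator (- S) x * (1 - g x))"
      using bd by (intro Bochner_Integration.integrable_diff int[of _ "1 + K"]) auto
    show "integrable \<mu> (\<lambda>x. \<bar>1 - g x\<bar>)" using bd by (intro integrable_bounded_borel[OF \<mu>, of _ "1 + K"]) auto
  qed (auto split: split_indicator)
  finally show "total_variation (signed_diff \<mu> (density \<mu> g)) \<le> (\<integral>x. \<bar>1 - g x\<bar> \<partial>\<mu>)" .
qed

section \<open>Bounds for the Wasserstein distance\<close>

lemma finite_moment_measuresD: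
  assumes "\<mu> \<in> finite_moment_measures p"
  shows "\<mu> \<in> finite_borel_measures"
  using assms by (simp add: finite_moment_measures_def)

lemma wasserstein_powr:
  assumes "p \<noteq> 0"
  shows "wasserstein p \<mu>1 \<mu>2 powr p = measure \<mu>1 UNIV *
    enn2real (INF \<pi>\<in>transport_plans \<mu>1 \<mu>2. \<integral>\<^sup>+(x, y). ennreal (dist x y powr p) \<partial>\<pi>)"
  using assms by (simp add: wasserstein_def powr_powr)

text \<open>Each summand is replaced by the largest of the three. The constant is crude, but the
  lemma serves only to show that a cost is finite.\<close>

lemma powr_triangle3:
  fixes x y z p :: real
  assumes "0 \<le> x" "0 \<le> y" "0 \<le> z" "0 \<le> p"
  shows "(x + y + z) powr p \<le> 3 powr p * (x powr p + y powr p + z powr p)"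
proof -
  define m where "m = max x (max y z)"
  have "(x + y + z) powr p \<le> (3 * m) powr p"
    using assms by (intro powr_mono2) (auto simp: m_def)
  also have "\<dots> = 3 powr p * m powr p" using assms by (intro powr_mult)
  also have "m powr p \<le> x powr p + y powr p + z powr p"
    by (auto simp: m_def max_def)
  finally show ?thesis by (simp add: mult_left_mono)
qed

lemma integral_transport_plan:
  fixes f :: "'a::second_countable_topology \<Rightarrow> real"
  assumes \<mu>: "\<mu>1 \<in> finite_borel_measures" "\<mu>2 \<in> finite_borel_measures"
    and \<pi>: "\<pi> \<in> transport_plans \<mu>1 \<mu>2" and f[measurable]: "f \<in> borel_measurable borel"
  shows "(\<integral>x. f x \<partial>\<mu>1) = measure \<mu>1 UNIV * (\<integral>z. f (fst z) \<partial>\<pi>)"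
    and "(\<integral>x. f x \<partial>\<mu>2) = measure \<mu>2 UNIV * (\<integral>z. f (snd z) \<partial>\<pi>)"
proof -
  interpret prob_space \<pi> using \<pi> by (simp add: transport_plans_def)
  have s: "sets \<pi> = sets (borel \<Otimes>\<^sub>M borel)" using \<pi> unfolding borel_prod by (simp add: transport_plans_def)
  note [measurable_cong] = s
  have sp: "space \<pi> = UNIV" using sets_eq_imp_space_eq[OF s] by (simp add: space_pair_measure)
  \<comment> \<open>Plans are normalised to mass 1, so \<mu>1 is the first marginal times its own
    mass. Writing the factor as a constant density makes the change of variables available, also
    when the mass is 0.\<close>
  have "\<mu>1 = density (distr \<pi> borel fst) (\<lambda>_. ennreal (measure \<mu>1 UNIV))"
  proof (rule measure_eqI)
    fix A assume "A \<in> sets \<mu>1"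
    then have A[measurable]: "A \<in> sets borel" by (simp add: finite_borel_measuresD[OF \<mu>(1)])
    have "fst -` A = A \<times> (UNIV :: 'a set)" by auto
    moreover have "measure \<mu>1 UNIV * measure \<pi> (A \<times> UNIV) = measure \<mu>1 A"
      using \<pi> A by (simp add: transport_plans_def)
    ultimately show "emeasure \<mu>1 A = emeasure (density (distr \<pi> borel fst) (\<lambda>_. ennreal (measure \<mu>1 UNIV))) A"
      using A finite_measure.emeasure_eq_measure[OF finite_borel_measuresD(1)[OF \<mu>(1)]]
      by (simp add: emeasure_density emeasure_distr nn_integral_cmult sp emeasure_eq_measure
          flip: ennreal_mult)
  qed (simp add: finite_borel_measuresD[OF \<mu>(1)])
  then have "(\<integral>x. f x \<partial>\<mu>1) = (\<integral>x. f x \<partial>density (distr \<pi> borel fst) (\<lambda>_. ennreal (measure \<mu>1 UNIV)))"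
    by simp
  also have "\<dots> = measure \<mu>1 UNIV * (\<integral>z. f (fst z) \<partial>\<pi>)"
    by (simp add: integral_density integral_distr)
  finally show "(\<integral>x. f x \<partial>\<mu>1) = measure \<mu>1 UNIV * (\<integral>z. f (fst z) \<partial>\<pi>)" .
  have "\<mu>2 = density (distr \<pi> borel snd) (\<lambda>_. ennreal (measure \<mu>2 UNIV))"
  proof (rule measure_eqI)
    fix A assume "A \<in> sets \<mu>2"
    then have A[measurable]: "A \<in> sets borel" by (simp add: finite_borel_measuresD[OF \<mu>(2)])
    have "snd -` A = (UNIV :: 'a set) \<times> A" by auto
    moreover have "measure \<mu>2 UNIV * measure \<pi> (UNIV \<times> A) = measure \<mu>2 A"
      using \<pi> A by (simp add: transport_plans_def)
    ultimately show "emeasure \<mu>2 A = emeasure (density (distr \<pi> borel snd) (\<lambda>_. ennreal (measure \<mu>2 UNIV))) A"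
      using A finite_measure.emeasure_eq_measure[OF finite_borel_measuresD(1)[OF \<mu>(2)]]
      by (simp add: emeasure_density emeasure_distr nn_integral_cmult sp emeasure_eq_measure
          flip: ennreal_mult)
  qed (simp add: finite_borel_measuresD[OF \<mu>(2)])
  then have "(\<integral>x. f x \<partial>\<mu>2) = (\<integral>x. f x \<partial>density (distr \<pi> borel snd) (\<lambda>_. ennreal (measure \<mu>2 UNIV)))"
    by simp
  also have "\<dots> = measure \<mu>2 UNIV * (\<integral>z. f (snd z) \<partial>\<pi>)"
    by (simp add: integral_density integral_distr)
  finally show "(\<integral>x. f x \<partial>\<mu>2) = measure \<mu>2 UNIV * (\<integral>z. f (snd z) \<partial>\<pi>)" .
qed

text \<open>The normalised product plan works, by the triangle inequality through two base points.
  Without a plan of finite cost the infimum in \<open>wasserstein\<close> would be \<infinity>,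
  which \<open>enn2real\<close> sends to 0, and weak duality could fail.\<close>

lemma finite_cost_transport_plan_exists:
  fixes \<mu>1 \<mu>2 :: "'a::{metric_space, second_countable_topology} measure"
  assumes p: "p \<ge> 0" and \<mu>: "\<mu>1 \<in> finite_moment_measures p" "\<mu>2 \<in> finite_moment_measures p"
    and M: "measure \<mu>1 UNIV = measure \<mu>2 UNIV" "measure \<mu>1 UNIV > 0"
  obtains \<pi> where "\<pi> \<in> transport_plans \<mu>1 \<mu>2" "(\<integral>\<^sup>+(x, y). ennreal (dist x y powr p) \<partial>\<pi>) < \<infinity>"
proof -
  note fb = \<mu>[THEN finite_moment_measuresD]
  obtain x1 x2 where x: "(\<integral>\<^sup>+x. ennreal (dist x x1 powr p) \<partial>\<mu>1) < \<infinity>" "(\<integral>\<^sup>+x. ennreal (dist x x2 powr p) \<partial>\<mu>2) < \<infinity>"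
    using \<mu> by (auto simp: finite_moment_measures_def)
  interpret f1: finite_measure \<mu>1 using finite_borel_measuresD(1)[OF fb(1)] .
  interpret f2: finite_measure \<mu>2 using finite_borel_measuresD(1)[OF fb(2)] .
  interpret pair_sigma_finite \<mu>1 \<mu>2 ..
  have s[measurable_cong]: "sets \<mu>1 = sets borel" "sets \<mu>2 = sets borel"
    and sp: "space \<mu>1 = UNIV" "space \<mu>2 = UNIV"
    using fb[THEN finite_borel_measuresD(2)] fb[THEN finite_borel_measuresD(3)] by auto
  define m where "m = measure \<mu>1 UNIV"
  have m: "m > 0" "measure \<mu>2 UNIV = m" using M by (auto simp: m_def)
  define \<pi> where "\<pi> = scale_measure (ennreal (1 / m\<^sup>2)) (\<mu>1 \<Otimes>\<^sub>M \<mu>2)"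
  have s\<pi>: "sets \<pi> = sets borel"
    unfolding \<pi>_def sets_scale_measure borel_prod[symmetric] by (rule sets_pair_measure_cong) (auto simp: s)
  have e: "emeasure \<pi> (A \<times> B) = ennreal (measure \<mu>1 A * measure \<mu>2 B / m\<^sup>2)" if "A \<in> sets borel" "B \<in> sets borel" for A B
    using that by (simp add: \<pi>_def s f2.emeasure_pair_measure_Times f1.emeasure_eq_measure f2.emeasure_eq_measure
        flip: ennreal_mult)
  have "emeasure \<pi> (UNIV \<times> UNIV) = 1"
    using m by (subst e) (auto simp: m_def power2_eq_square)
  then have "prob_space \<pi>"
    using sets_eq_imp_space_eq[OF s\<pi>] by (intro prob_spaceI) simp
  moreover have "measure \<pi> (A \<times> B) = measure \<mu>1 A * measure \<mu>2 B / m\<^sup>2" if "A \<in> sets borel" "B \<in> sets borel" for A B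
    unfolding measure_def[of \<pi>] using e[OF that] by simp
  then have "measure \<mu>1 UNIV * measure \<pi> (A \<times> UNIV) = measure \<mu>1 A"
    "measure \<mu>2 UNIV * measure \<pi> (UNIV \<times> A) = measure \<mu>2 A" if "A \<in> sets borel" for A
    using that m by (simp_all add: power2_eq_square flip: m_def)
  ultimately have plan: "\<pi> \<in> transport_plans \<mu>1 \<mu>2"
    using s\<pi> by (simp add: transport_plans_def)
  have "(\<integral>\<^sup>+z. ennreal (dist (fst z) (snd z) powr p) \<partial>(\<mu>1 \<Otimes>\<^sub>M \<mu>2))
      \<le> (\<integral>\<^sup>+z. ennreal (3 powr p) * (ennreal (dist (fst z) x1 powr p) + ennreal (dist x1 x2 powr p)
           + ennreal (dist (snd z) x2 powr p)) \<partial>(\<mu>1 \<Otimes>\<^sub>M \<mu>2))"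
  proof (intro nn_integral_mono)
    fix z :: "'a \<times> 'a"
    have "dist (fst z) (snd z) \<le> dist (fst z) x1 + dist x1 x2 + dist (snd z) x2"
      using dist_triangle[of "fst z" "snd z" x1] dist_triangle[of x1 "snd z" x2] by (simp add: dist_commute)
    then have "dist (fst z) (snd z) powr p \<le> (dist (fst z) x1 + dist x1 x2 + dist (snd z) x2) powr p"
      using p by (intro powr_mono2) auto
    also have "\<dots> \<le> 3 powr p * (dist (fst z) x1 powr p + dist x1 x2 powr p + dist (snd z) x2 powr p)"
      using p by (intro powr_triangle3) auto
    finally show "ennreal (dist (fst z) (snd z) powr p) \<le> ennreal (3 powr p) *
        (ennreal (dist (fst z) x1 powr p) + ennreal (dist x1 x2 powr p) + ennreal (dist (snd z) x2 powr p))"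
      by (simp add: ennreal_leI flip: ennreal_plus ennreal_mult)
  qed
  also have "\<dots> = ennreal (3 powr p) * ((\<integral>\<^sup>+z. ennreal (dist (fst z) x1 powr p) \<partial>(\<mu>1 \<Otimes>\<^sub>M \<mu>2))
      + (\<integral>\<^sup>+z. ennreal (dist x1 x2 powr p) \<partial>(\<mu>1 \<Otimes>\<^sub>M \<mu>2)) + (\<integral>\<^sup>+z. ennreal (dist (snd z) x2 powr p) \<partial>(\<mu>1 \<Otimes>\<^sub>M \<mu>2)))"
    by (subst nn_integral_cmult, measurable, subst nn_integral_add, measurable, subst nn_integral_add, measurable)
  also have "(\<integral>\<^sup>+z. ennreal (dist (fst z) x1 powr p) \<partial>(\<mu>1 \<Otimes>\<^sub>M \<mu>2))
      = (\<integral>\<^sup>+x. ennreal (dist x x1 powr p) \<partial>\<mu>1) * emeasure \<mu>2 UNIV"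
    by (subst f2.nn_integral_fst[symmetric]) (auto simp: sp nn_integral_multc)
  also have "(\<integral>\<^sup>+z. ennreal (dist (snd z) x2 powr p) \<partial>(\<mu>1 \<Otimes>\<^sub>M \<mu>2))
      = (\<integral>\<^sup>+x. ennreal (dist x x2 powr p) \<partial>\<mu>2) * emeasure \<mu>1 UNIV"
    by (subst f2.nn_integral_fst[symmetric]) (auto simp: sp)
  also have "(\<integral>\<^sup>+z. ennreal (dist x1 x2 powr p) \<partial>(\<mu>1 \<Otimes>\<^sub>M \<mu>2)) = ennreal (dist x1 x2 powr p) * (emeasure \<mu>1 UNIV * emeasure \<mu>2 UNIV)"
    using f2.emeasure_pair_measure_Times[where A=UNIV and B=UNIV and N=\<mu>1] by (simp add: space_pair_measure sp s)
  finally have "(\<integral>\<^sup>+(x, y). ennreal (dist x y powr p) \<partial>(\<mu>1 \<Otimes>\<^sub>M \<mu>2)) < \<infinity>"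
    using x by (auto simp: split_def ennreal_mult_less_top f1.emeasure_eq_measure f2.emeasure_eq_measure
        elim!: order.strict_trans1)
  moreover have "(\<integral>\<^sup>+(x, y). ennreal (dist x y powr p) \<partial>\<pi>)
      = ennreal (1 / m\<^sup>2) * (\<integral>\<^sup>+(x, y). ennreal (dist x y powr p) \<partial>(\<mu>1 \<Otimes>\<^sub>M \<mu>2))"
    unfolding \<pi>_def by (rule nn_integral_scale_measure) measurable
  ultimately have "(\<integral>\<^sup>+(x, y). ennreal (dist x y powr p) \<partial>\<pi>) < \<infinity>"
    by (simp add: ennreal_mult_less_top)
  then show ?thesis using that plan by blast
qed

lemma wasserstein_weak_duality:
  fixes \<mu>1 \<mu>2 :: "'a::{metric_space, second_countable_topology} measure"
  assumes p: "p > 0" and b: "b > 0"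
    and \<mu>: "\<mu>1 \<in> finite_moment_measures p" "\<mu>2 \<in> finite_moment_measures p"
    and M: "measure \<mu>1 UNIV = measure \<mu>2 UNIV"
    and f: "f \<in> borel_measurable borel" "\<And>x. \<bar>f x\<bar> \<le> K"
    and g: "g \<in> borel_measurable borel" "\<And>x. \<bar>g x\<bar> \<le> K"
    and fg: "\<And>x y. f x + g y \<le> (b * dist x y) powr p"
  shows "(\<integral>x. f x \<partial>\<mu>1) + (\<integral>x. g x \<partial>\<mu>2) \<le> b powr p * wasserstein p \<mu>1 \<mu>2 powr p"
proof (cases "measure \<mu>1 UNIV = 0")
  note fb = \<mu>[THEN finite_moment_measuresD]
  case True
  have "integral\<^sup>L \<mu> h = 0" if "\<mu> \<in> finite_borel_measures" "measure \<mu> UNIV = 0" for \<mu> :: "'a measure" and h :: "'a \<Rightarrow> real"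
  proof -
    have "emeasure \<mu> UNIV = 0"
      using that finite_measure.emeasure_eq_measure[OF finite_borel_measuresD(1)[OF that(1)]] by simp
    then have "AE x in \<mu>. h x = 0"
      using finite_borel_measuresD[OF that(1)] by (intro AE_I[of _ _ UNIV]) auto
    then show ?thesis by (rule integral_eq_zero_AE)
  qed
  then show ?thesis using True M fb by simp
next
  note fb = \<mu>[THEN finite_moment_measuresD]
  case False
  define m where "m = measure \<mu>1 UNIV"
  have m: "m > 0" "measure \<mu>2 UNIV = m" using M False by (auto simp: m_def less_le)
  define C where "C = (INF \<pi>\<in>transport_plans \<mu>1 \<mu>2. \<integral>\<^sup>+(x, y). ennreal (dist x y powr p) \<partial>\<pi>)"
  \<comment> \<open>The dual value, divided by the mass and by \<open>b powr p\<close>, is on the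
    same scale as the infimum \<open>C\<close> over probability plans with unscaled cost. It may be
    negative, in which case \<open>ennreal R\<close> is 0.\<close>
  define R where "R = ((\<integral>x. f x \<partial>\<mu>1) + (\<integral>x. g x \<partial>\<mu>2)) / (m * b powr p)"
  obtain \<pi>0 where "\<pi>0 \<in> transport_plans \<mu>1 \<mu>2" "(\<integral>\<^sup>+(x, y). ennreal (dist x y powr p) \<partial>\<pi>0) < \<infinity>"
    using finite_cost_transport_plan_exists[OF _ \<mu> M] p m m_def by force
  then have C: "C < \<infinity>" unfolding C_def by (meson INF_lower order.strict_trans1)
  have "ennreal R \<le> C"
    unfolding C_def
  proof (rule INF_greatest)
    fix \<pi> assume \<pi>: "\<pi> \<in> transport_plans \<mu>1 \<mu>2"
    interpret prob_space \<pi> using \<pi> by (simp add: transport_plans_def)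
    have s[measurable_cong]: "sets \<pi> = sets (borel \<Otimes>\<^sub>M borel)" using \<pi> unfolding borel_prod by (simp add: transport_plans_def)
    note [measurable] = f(1) g(1)
    define h where "h z = (f (fst z) + g (snd z)) / b powr p" for z
    have "\<bar>f (fst z) + g (snd z)\<bar> \<le> 2 * K" for z using f(2)[of "fst z"] g(2)[of "snd z"] by linarith
    then have ih: "integrable \<pi> h"
      using b by (intro integrable_const_bound[of _ "2 * K / b powr p"]) (auto simp: h_def[abs_def] divide_right_mono)
    have ifg: "integrable \<pi> (\<lambda>z. f (fst z))" "integrable \<pi> (\<lambda>z. g (snd z))"
      using f g by (auto intro!: integrable_const_bound[of _ K])
    have "(\<integral>x. f x \<partial>\<mu>1) = m * (\<integral>z. f (fst z) \<partial>\<pi>)" "(\<integral>x. g x \<partial>\<mu>2) = m * (\<integral>z. g (snd z) \<partial>\<pi>)"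
      using integral_transport_plan(1)[OF fb \<pi> f(1)] integral_transport_plan(2)[OF fb \<pi> g(1)] m
      by (simp_all only: m_def)
    then have "R = ((\<integral>z. f (fst z) \<partial>\<pi>) + (\<integral>z. g (snd z) \<partial>\<pi>)) / b powr p"
      unfolding R_def using m by (simp flip: distrib_left)
    also have "\<dots> = (\<integral>z. h z \<partial>\<pi>)"
      unfolding h_def using ifg by simp
    finally have "R = (\<integral>z. h z \<partial>\<pi>)" .
    also have "ennreal \<dots> \<le> (\<integral>\<^sup>+z. ennreal (h z) \<partial>\<pi>)"
    proof -
      \<comment> \<open>\<open>ennreal\<close> cuts negative values to 0, so the comparison goes
        through the positive part of \<open>h\<close>.\<close>
      have "ennreal (\<integral>z. h z \<partial>\<pi>) \<le> ennreal (\<integral>z. max 0 (h z) \<partial>\<pi>)"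
        using ih by (intro ennreal_leI integral_mono) auto
      also have "\<dots> = (\<integral>\<^sup>+z. ennreal (max 0 (h z)) \<partial>\<pi>)"
        using ih by (intro nn_integral_eq_integral[symmetric]) auto
      finally show ?thesis by (simp add: ennreal_max_0)
    qed
    also have "\<dots> \<le> (\<integral>\<^sup>+z. ennreal (dist (fst z) (snd z) powr p) \<partial>\<pi>)"
      using fg b by (intro nn_integral_mono ennreal_leI) (simp add: h_def powr_mult field_simps)
    finally show "ennreal R \<le> (\<integral>\<^sup>+(x, y). ennreal (dist x y powr p) \<partial>\<pi>)" by (simp add: split_def)
  qed
  then have "R \<le> enn2real C"
    using C by (metis enn2real_ennreal enn2real_mono enn2real_nonneg infinity_ennreal_def linorder_le_cases order_trans)
  then have "R * (m * b powr p) \<le> enn2real C * (m * b powr p)"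
    using m b by (intro mult_right_mono) auto
  moreover have "R * (m * b powr p) = (\<integral>x. f x \<partial>\<mu>1) + (\<integral>x. g x \<partial>\<mu>2)" using m b by (simp add: R_def)
  ultimately show ?thesis
    using p by (simp add: wasserstein_powr m_def C_def algebra_simps)
qed

text \<open>After normalisation, \<gamma> is itself a plan between its two marginals. The factor
  \<open>measure \<mu>1 UNIV\<close> in \<open>wasserstein\<close> cancels this normalisation, so
  the cost of the unnormalised coupling is the bound.\<close>

lemma wasserstein_distr_le:
  fixes \<gamma> :: "('a::{metric_space, second_countable_topology} \<times> 'a) measure"
  assumes p: "p > 0" and \<gamma>: "\<gamma> \<in> finite_borel_measures"
    and K: "(\<integral>\<^sup>+(x, y). ennreal (dist x y powr p) \<partial>\<gamma>) \<le> ennreal K" "K \<ge> 0"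
  shows "wasserstein p (distr \<gamma> borel fst) (distr \<gamma> borel snd) powr p \<le> K"
proof -
  interpret finite_measure \<gamma> using finite_borel_measuresD(1)[OF \<gamma>] .
  have s[measurable_cong]: "sets \<gamma> = sets (borel \<Otimes>\<^sub>M borel)" and sp: "space \<gamma> = UNIV"
    unfolding borel_prod using finite_borel_measuresD[OF \<gamma>] by auto
  define m where "m = measure \<gamma> UNIV"
  have d1: "measure (distr \<gamma> borel fst) A = measure \<gamma> (A \<times> UNIV)" if "A \<in> sets borel" for A
  proof -
    have "fst -` A = A \<times> (UNIV :: 'a set)" by auto
    then show ?thesis using that by (simp add: measure_distr sp)
  qed
  have d2: "measure (distr \<gamma> borel snd) A = measure \<gamma> (UNIV \<times> A)" if "A \<in> sets borel" for A
  proof -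
    have "snd -` A = (UNIV :: 'a set) \<times> A" by auto
    then show ?thesis using that by (simp add: measure_distr sp)
  qed
  show ?thesis
  proof (cases "m = 0")
    case True
    then show ?thesis using p K by (simp add: wasserstein_powr d1 m_def)
  next
    case False
    then have m: "m > 0" by (simp add: m_def less_le)
    define \<pi> where "\<pi> = scale_measure (ennreal (1 / m)) \<gamma>"
    have e: "emeasure \<pi> A = ennreal (measure \<gamma> A / m)" and me: "measure \<pi> A = measure \<gamma> A / m" for A
      using m by (auto simp: \<pi>_def emeasure_eq_measure simp flip: ennreal_mult)
    have "prob_space \<pi>"
      using m by (intro prob_spaceI) (simp add: e, simp add: \<pi>_def space_scale_measure sp m_def)
    then have "\<pi> \<in> transport_plans (distr \<gamma> borel fst) (distr \<gamma> borel snd)"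
    proof -
      have "sets \<pi> = sets borel" using finite_borel_measuresD(2)[OF \<gamma>] by (simp add: \<pi>_def)
      moreover have "measure \<gamma> (UNIV \<times> UNIV) = m" by (simp add: m_def)
      ultimately show ?thesis using \<open>prob_space \<pi>\<close> m by (simp add: transport_plans_def d1 d2 me)
    qed
    then have "(INF \<pi>\<in>transport_plans (distr \<gamma> borel fst) (distr \<gamma> borel snd). \<integral>\<^sup>+(x, y). ennreal (dist x y powr p) \<partial>\<pi>)
        \<le> (\<integral>\<^sup>+(x, y). ennreal (dist x y powr p) \<partial>\<pi>)"
      by (rule INF_lower)
    also have "\<dots> = ennreal (1 / m) * (\<integral>\<^sup>+(x, y). ennreal (dist x y powr p) \<partial>\<gamma>)"
      unfolding \<pi>_def by (rule nn_integral_scale_measure) measurable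
    also have "\<dots> \<le> ennreal (1 / m) * ennreal K" using K by (intro mult_left_mono) auto
    also have "\<dots> = ennreal (K / m)" using m K by (simp flip: ennreal_mult)
    finally have "enn2real (INF \<pi>\<in>transport_plans (distr \<gamma> borel fst) (distr \<gamma> borel snd).
        \<integral>\<^sup>+(x, y). ennreal (dist x y powr p) \<partial>\<pi>) \<le> K / m"
      using m K by (intro enn2real_leI) auto
    then show ?thesis
      using p m by (simp add: wasserstein_powr d1 field_simps flip: m_def)
  qed
qed

section \<open>Extension of discrete potentials\<close>

text \<open>A pointwise infimum inherits a modulus of continuity shared by all members of the
  family. The lower bound \<open>L\<close> makes the real-valued infima meaningful.\<close>

lemma cINF_le_cINF_add:
  fixes L :: real
  assumes "H \<noteq> {}" "\<And>h. h \<in> H \<Longrightarrow> L \<le> h x" "\<And>h. h \<in> H \<Longrightarrow> h x \<le> h y + e"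
  shows "(INF h\<in>H. h x) \<le> (INF h\<in>H. h y) + e"
proof -
  have "bdd_below ((\<lambda>h. h x) ` H)" by (rule bdd_belowI2) (rule assms(2))
  then have "(INF h\<in>H. h x) - e \<le> (INF h\<in>H. h y)"
    using assms(1,3) by (intro cINF_greatest) (auto simp: diff_le_eq intro: cINF_lower2)
  then show ?thesis by simp
qed

text \<open>A one-sided estimate suffices because \<open>x\<close> and \<open>y\<close> may be
  exchanged. This is the form that estimates for infima deliver.\<close>

lemma continuous_on_of_modulus:
  fixes f :: "'a::metric_space \<Rightarrow> real"
  assumes "\<And>e. e > 0 \<Longrightarrow> \<exists>d>0. \<forall>x y. dist x y < d \<longrightarrow> f x \<le> f y + e"
  shows "continuous_on UNIV f"
  unfolding continuous_on_iff
proof (intro ballI allI impI)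
  fix x and e :: real assume "e > 0"
  then obtain d where d: "d > 0" "\<And>x y. dist x y < d \<Longrightarrow> f x \<le> f y + e / 2" using assms[of "e / 2"] by auto
  show "\<exists>d>0. \<forall>y\<in>UNIV. dist y x < d \<longrightarrow> dist (f y) (f x) < e"
  proof (intro exI[of _ d] conjI ballI impI)
    fix y assume "dist y x < d"
    then have "f x \<le> f y + e / 2" "f y \<le> f x + e / 2" using d(2) by (auto simp: dist_commute)
    then show "dist (f y) (f x) < e" using \<open>e > 0\<close> by (simp add: dist_real_def abs_less_iff)
  qed (rule d(1))
qed

text \<open>At \<open>R\<close> the power reaches the height \<open>T\<close> of the cut, and beyond
  it the truncated function is constant. Clamping the argument to the compact interval from 0 to
  \<open>R\<close> does not increase distances, so uniform continuity there is enough.\<close>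

lemma truncated_powr_modulus:
  fixes b p T e :: real
  assumes "p > 0" "b > 0" "T \<ge> 0" "e > 0"
  obtains d where "d > 0"
    "\<And>s t. 0 \<le> s \<Longrightarrow> 0 \<le> t \<Longrightarrow> \<bar>s - t\<bar> < d \<Longrightarrow> \<bar>min ((b * s) powr p) T - min ((b * t) powr p) T\<bar> \<le> e"
proof -
  define h where "h t = min ((b * t) powr p) T" for t
  define R where "R = T powr (1 / p) / b"
  have R: "R \<ge> 0" "(b * R) powr p = T" using assms by (auto simp: R_def powr_powr)
  have hR: "h (min t R) = h t" if "0 \<le> t" for t
  proof (cases "t \<le> R")
    case False
    then have "T \<le> (b * t) powr p" using assms R by (subst R(2)[symmetric]) (intro powr_mono2 mult_left_mono, auto)
    then show ?thesis using False R by (simp add: h_def)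
  qed simp
  have "uniformly_continuous_on {0..R} h"
    unfolding h_def using assms 
    by (intro compact_uniformly_continuous continuous_on_min continuous_on_powr') (auto intro!: continuous_intros)
  then obtain d where d: "d > 0" "\<And>s t. s \<in> {0..R} \<Longrightarrow> t \<in> {0..R} \<Longrightarrow> dist s t < d \<Longrightarrow> dist (h s) (h t) < e"
    unfolding uniformly_continuous_on_def using assms(4) by metis
  show ?thesis
  proof (rule that[OF d(1)])
    fix s t :: real assume st: "0 \<le> s" "0 \<le> t" "\<bar>s - t\<bar> < d"
    have "dist (h (min s R)) (h (min t R)) < e"
      using st R by (intro d(2)) (auto simp: dist_real_def min_def)
    then show "\<bar>min ((b * s) powr p) T - min ((b * t) powr p) T\<bar> \<le> e"
      using hR st by (simp add: dist_real_def flip: h_def)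
  qed
qed

lemma real_I_fun:
  assumes "a > 0" "- a \<le> t"
  shows "real_of_ereal (I_fun a t) = min t a"
  using assms by (simp add: I_fun_cases)

text \<open>The \<open>c\<close>-transform, applied twice, for the truncated (hence uniformly continuous) cost.\<close>

lemma Phi_W_extension:
  fixes z :: "'i \<Rightarrow> 'a::metric_space" and u v :: "'i \<Rightarrow> real"
  assumes a: "a > 0" and b: "b > 0" and p: "p > 0" and T: "T \<ge> 0" and \<kappa>: "\<kappa> \<ge> 0" and e: "e \<ge> 0"
    and u: "\<And>i. i \<in> I \<Longrightarrow> \<bar>u i\<bar> \<le> a" and v: "\<And>j. j \<in> J \<Longrightarrow> \<bar>v j\<bar> \<le> a"
    and uv: "\<And>i j. i \<in> I \<Longrightarrow> j \<in> J \<Longrightarrow> u i + v j \<le> min ((b * dist (z i) (z j)) powr p) T + \<kappa>"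
    and d: "\<And>s t. 0 \<le> s \<Longrightarrow> 0 \<le> t \<Longrightarrow> \<bar>s - t\<bar> < d \<Longrightarrow>
      \<bar>min ((b * s) powr p) T - min ((b * t) powr p) T\<bar> \<le> e"
  obtains \<phi>1 \<phi>2 :: "'a \<Rightarrow>\<^sub>C real" where "(\<phi>1, \<phi>2) \<in> Phi_W a b p"
    "\<And>i x. i \<in> I \<Longrightarrow> dist x (z i) < d \<Longrightarrow> u i - \<kappa> - e \<le> min (\<phi>1 x) a"
    "\<And>j y. j \<in> J \<Longrightarrow> dist y (z j) < d \<Longrightarrow> v j - e \<le> min (\<phi>2 y) a"
proof -
  define q where "q t = min ((b * t) powr p) T" for t
  have q: "0 \<le> q t" "q t \<le> T" "q t \<le> (b * t) powr p" for t using T by (auto simp: q_def)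
  have qd: "q (dist x w) \<le> q (dist y w) + e" "q (dist w x) \<le> q (dist w y) + e" if "dist x y < d" for x y w :: 'a
  proof -
    have "\<bar>dist x w - dist y w\<bar> < d" using that abs_dist_diff_le[of x w y] by (simp add: dist_commute)
    then show "q (dist x w) \<le> q (dist y w) + e" using d[of "dist x w" "dist y w"] by (simp add: q_def abs_le_iff)
    then show "q (dist w x) \<le> q (dist w y) + e" by (simp add: dist_commute)
  qed
  \<comment> \<open>The pair \<open>d\<close>, \<open>e\<close> given in the assumptions fixes a
    single scale. Continuity of the potentials requires a modulus at every scale.\<close>
  have q_mod: "\<exists>d>0. \<forall>x y w :: 'a. dist x y < d \<longrightarrow> q (dist x w) \<le> q (dist y w) + e" if "e > 0" for e
  proof -
    obtain d where d: "d > 0" "\<And>s t. 0 \<le> s \<Longrightarrow> 0 \<le> t \<Longrightarrow> \<bar>s - t\<bar> < d \<Longrightarrow> \<bar>q s - q t\<bar> \<le> e"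
      unfolding q_def using truncated_powr_modulus[OF p b T \<open>e > 0\<close>] by blast
    have "q (dist x w) \<le> q (dist y w) + e" if "dist x y < d" for x y w :: 'a
    proof -
      have "\<bar>dist x w - dist y w\<bar> < d" using that abs_dist_diff_le[of x w y] by (simp add: dist_commute)
      then show ?thesis using d(2)[of "dist x w" "dist y w"] by (simp add: abs_le_iff)
    qed
    then show ?thesis using d(1) by blast
  qed
  \<comment> \<open>The infimum over \<open>H\<close> is the c-transform of \<open>v\<close>, capped
    at \<open>a\<close> by the inserted constant. The cap makes the second transform at least
    \<open>- a\<close>, and it keeps the family nonempty when \<open>J\<close> is empty.\<close>
  define H where "H = insert (\<lambda>_. a) ((\<lambda>j x. q (dist x (z j)) - v j) ` J)"
  define f where "f x = (INF h\<in>H. h x)" for x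
  have H: "H \<noteq> {}" "\<And>h x. h \<in> H \<Longrightarrow> - a \<le> h x"
  proof -
    fix h x assume "h \<in> H"
    moreover have "- a \<le> q (dist x (z j)) - v j" if "j \<in> J" for j using q(1)[of "dist x (z j)"] v[OF that] by linarith
    ultimately show "- a \<le> h x" using a by (auto simp: H_def)
  qed (simp add: H_def)
  have bH: "bdd_below ((\<lambda>h. h x) ` H)" for x by (rule bdd_belowI2) (rule H(2))
  have f_le: "f x \<le> h x" if "h \<in> H" for h x unfolding f_def using that by (intro cINF_lower bH)
  have fa: "f x \<le> a" for x using f_le[of "\<lambda>_. a" x] by (simp add: H_def)
  have fv: "f x \<le> q (dist x (z j)) - v j" if "j \<in> J" for x j
    using f_le[of "\<lambda>x. q (dist x (z j)) - v j" x] that by (simp add: H_def)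
  have fl: "- a \<le> f x" for x unfolding f_def using H by (intro cINF_greatest)
  have f_mod: "f x \<le> f y + e" if "e \<ge> 0" "\<And>w. q (dist x w) \<le> q (dist y w) + e" for x y e
    unfolding f_def
  proof (rule cINF_le_cINF_add[OF H])
    fix h assume "h \<in> H" then show "h x \<le> h y + e" using that by (auto simp: H_def algebra_simps)
  qed
  \<comment> \<open>Here the infimum runs over the whole space and not over the cell centres, so the
    constraint between \<open>f\<close> and \<open>g\<close> holds for all pairs of points by
    construction.\<close>
  define g where "g y = (INF x. q (dist x y) - f x)" for y
  have gl: "- a \<le> q (dist x y) - f x" for x y using q(1)[of "dist x y"] fa[of x] by linarith
  have bG: "bdd_below (range (\<lambda>x. q (dist x y) - f x))" for y by (rule bdd_belowI2) (rule gl)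
  have g_le: "g y \<le> q (dist x y) - f x" for x y unfolding g_def by (intro cINF_lower bG) auto
  have ga: "- a \<le> g y" for y unfolding g_def by (intro cINF_greatest gl) auto
  have gT: "g y \<le> T + a" for y using g_le[of y y] q(2)[of "dist y y"] fl[of y] by linarith
  have g_mod: "g x \<le> g y + e" if "\<And>w. q (dist w x) \<le> q (dist w y) + e" for x y e
  proof -
    have "(INF h\<in>range (\<lambda>w y. q (dist w y) - f w). h x) \<le> (INF h\<in>range (\<lambda>w y. q (dist w y) - f w). h y) + e"
      using that by (intro cINF_le_cINF_add[where L="- a"]) (auto intro: gl simp: algebra_simps)
    then show ?thesis by (simp add: g_def image_image)
  qed
  have "continuous_on UNIV f"
  proof (rule continuous_on_of_modulus)
    fix e :: real assume "e > 0"
    then show "\<exists>d>0. \<forall>x y. dist x y < d \<longrightarrow> f x \<le> f y + e"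
      using q_mod[OF \<open>e > 0\<close>] f_mod[of e] by (metis less_eq_real_def)
  qed
  then have "f \<in> bcontfun" using fa fl by (intro bcontfun_normI[of _ a]) (auto simp: abs_le_iff minus_le_iff)
  then obtain \<phi>1 where \<phi>1: "f = apply_bcontfun \<phi>1" by (rule bcontfunE)
  have "continuous_on UNIV g"
  proof (rule continuous_on_of_modulus)
    fix e :: real assume "e > 0"
    then show "\<exists>d>0. \<forall>x y. dist x y < d \<longrightarrow> g x \<le> g y + e"
      using q_mod[OF \<open>e > 0\<close>] g_mod[of _ _ e] by (metis dist_commute)
  qed
  moreover have "\<bar>g y\<bar> \<le> T + a" for y using ga[of y] gT[of y] T by linarith
  ultimately have "g \<in> bcontfun" by (intro bcontfun_normI[of _ "T + a"]) auto
  then obtain \<phi>2 where \<phi>2: "g = apply_bcontfun \<phi>2" by (rule bcontfunE)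
  show ?thesis
  proof (rule that[of \<phi>1 \<phi>2])
    have "f x + g y \<le> (b * dist x y) powr p" for x y using g_le[of y x] q(3)[of "dist x y"] by linarith
    then show "(\<phi>1, \<phi>2) \<in> Phi_W a b p" using fl ga by (simp add: Phi_W_def flip: \<phi>1 \<phi>2)
  next
    fix i x assume i: "i \<in> I" "dist x (z i) < d"
    have "u i - \<kappa> - e \<le> f x"
      unfolding f_def
    proof (rule cINF_greatest[OF H(1)])
      fix h assume "h \<in> H"
      moreover have "u i - \<kappa> - e \<le> a" using u[OF i(1)] \<kappa> e by linarith
      \<comment> \<open>\<kappa> is the slack of the discrete constraint, and \<open>e\<close> is
        the price of moving \<open>x\<close> to the centre \<open>z i\<close>.\<close>
      moreover have "u i - \<kappa> - e \<le> q (dist x (z j)) - v j" if "j \<in> J" for j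
        using uv[OF i(1) that] qd(1)[of "z i" x "z j"] i(2) by (simp add: q_def dist_commute)
      ultimately show "u i - \<kappa> - e \<le> h x" by (auto simp: H_def)
    qed
    then show "u i - \<kappa> - e \<le> min (\<phi>1 x) a" using fa[of x] by (simp flip: \<phi>1)
  next
    fix j y assume j: "j \<in> J" "dist y (z j) < d"
    \<comment> \<open>The first transform was bounded using the centre \<open>z j\<close>;
      exchanging \<open>z j\<close> for \<open>y\<close> in the cost loses \<open>e\<close> and
      nothing else.\<close>
    have "v j - e \<le> q (dist x y) - f x" for x
      using fv[OF j(1), of x] qd(2)[of "z j" y x] j(2) by (simp add: dist_commute)
    then have "v j - e \<le> g y" unfolding g_def by (intro cINF_greatest) auto
    then show "v j - e \<le> min (\<phi>2 y) a" using v[OF j(1)] e by (auto simp flip: \<phi>2)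
  qed
qed

section \<open>Partitions into countably many small cells\<close>

lemma fine_partition:
  fixes \<mu> \<nu> :: "'a::{metric_space, second_countable_topology} measure"
  assumes \<mu>: "\<mu> \<in> finite_borel_measures" and \<nu>: "\<nu> \<in> finite_borel_measures" and "d > 0" "e > 0"
  obtains A :: "nat \<Rightarrow> 'a set" and z n where "disjoint_family A" "\<And>i. A i \<in> sets borel"
    "\<And>i x. x \<in> A i \<Longrightarrow> dist x (z i) < d"
    "measure \<mu> (- (\<Union>i<n. A i)) < e" "measure \<nu> (- (\<Union>i<n. A i)) < e"
proof -
  obtain D :: "'a set" where D: "countable D" "\<And>X. open X \<Longrightarrow> X \<noteq> {} \<Longrightarrow> \<exists>d\<in>D. d \<in> X"
    by (rule countable_dense_setE) blast
  have "D \<noteq> {}" using D(2)[of UNIV] by auto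
  define z where "z = from_nat_into D"
  have rz: "range z = D" using D(1) \<open>D \<noteq> {}\<close> by (simp add: z_def range_from_nat_into)
  \<comment> \<open>Balls of radius \<open>d\<close> around a countable dense set cover the space,
    and making them disjoint keeps the union. Continuity from above then leaves small mass outside
    finitely many of them, for both measures with the same \<open>n\<close>.\<close>
  define A where "A = disjointed (\<lambda>i. ball (z i) d)"
  have A[measurable]: "A i \<in> sets borel" for i
    using sets.range_disjointed_sets[of "\<lambda>i. ball (z i) d" borel] 
    by (auto simp: A_def image_subset_iff)
  have "\<exists>i. x \<in> ball (z i) d" for x
    using D(2)[of "ball x d"] \<open>d > 0\<close> by (force simp: dist_commute simp flip: rz)
  then have U: "(\<Union>i. A i) = UNIV" unfolding A_def UN_disjointed_eq by auto
  have lim: "(\<lambda>n. measure \<mu> (- (\<Union>i<n. A i))) \<longlonglongrightarrow> 0" if "\<mu> \<in> finite_borel_measures" for \<mu> :: "'a measure"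
  proof -
    interpret finite_measure \<mu> using finite_borel_measuresD(1)[OF that] .
    note s[measurable_cong] = finite_borel_measuresD(2)[OF that]
    have "(\<lambda>n. measure \<mu> (- (\<Union>i<n. A i))) \<longlonglongrightarrow> measure \<mu> (\<Inter>n. - (\<Union>i<n. A i))"
    proof (rule finite_Lim_measure_decseq)
      have "(\<Union>i<n. A i) \<in> sets borel" for n using A by auto
      then show "range (\<lambda>n. - (\<Union>i<n. A i)) \<subseteq> sets \<mu>" unfolding s using borel_comp by blast
      show "decseq (\<lambda>n. - (\<Union>i<n. A i))" by (fastforce simp: decseq_def)
    qed
    also have "(\<Inter>n. - (\<Union>i<n. A i)) = {}"
    proof -
      have "\<exists>n. x \<in> (\<Union>i<n. A i)" for x
      proof -
        obtain i where "x \<in> A i" using U by auto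
        then have "x \<in> (\<Union>i<Suc i. A i)" by auto
        then show ?thesis by blast
      qed
      then show ?thesis by blast
    qed
    finally show ?thesis by simp
  qed
  have "eventually (\<lambda>n. measure \<mu> (- (\<Union>i<n. A i)) < e \<and> measure \<nu> (- (\<Union>i<n. A i)) < e) sequentially"
    using order_tendstoD(2)[OF lim[OF \<mu>] \<open>e > 0\<close>] order_tendstoD(2)[OF lim[OF \<nu>] \<open>e > 0\<close>]
    by (rule eventually_conj)
  then obtain n where "measure \<mu> (- (\<Union>i<n. A i)) < e" "measure \<nu> (- (\<Union>i<n. A i)) < e"
    by (auto simp: eventually_sequentially)
  moreover have "dist x (z i) < d" if "x \<in> A i" for x i
    using that disjointed_subset[of "\<lambda>i. ball (z i) d" i] by (auto simp: A_def dist_commute)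
  moreover have "disjoint_family A" unfolding A_def by (rule disjoint_family_disjointed)
  ultimately show ?thesis using that A by blast
qed

section \<open>Discretisation by cells\<close>

lemma sum_indicator_cells:
  fixes t :: "'i \<Rightarrow> real"
  assumes "disjoint_family_on A I" "finite I" "i \<in> I" "x \<in> A i"
  shows "(\<Sum>j\<in>I. t j * indicator (A j) x) = t i"
proof -
  have "(\<Sum>j\<in>I. t j * indicator (A j) x) = (\<Sum>j\<in>I. if j = i then t i else 0)"
    using assms by (intro sum.cong) (auto simp: disjoint_family_on_def indicator_def)
  then show ?thesis using assms by simp
qed

lemma integral_sum_indicator_cells:
  fixes t :: "'i \<Rightarrow> real"
  assumes \<mu>: "\<mu> \<in> finite_borel_measures" and A: "\<And>i. i \<in> I \<Longrightarrow> A i \<in> sets borel"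
  shows "integrable \<mu> (\<lambda>x. \<Sum>i\<in>I. t i * indicator (A i) x)"
    and "(\<integral>x. (\<Sum>i\<in>I. t i * indicator (A i) x) \<partial>\<mu>) = (\<Sum>i\<in>I. t i * measure \<mu> (A i))"
proof -
  interpret finite_measure \<mu> using finite_borel_measuresD(1)[OF \<mu>] .
  have i: "integrable \<mu> (\<lambda>x. t i * indicator (A i) x)" if "i \<in> I" for i
    using A[OF that] finite_borel_measuresD(2)[OF \<mu>] emeasure_finite[of "A i"]
    by (intro integrable_mult_right integrable_real_indicator) (auto simp: less_top[symmetric])
  then show "integrable \<mu> (\<lambda>x. \<Sum>i\<in>I. t i * indicator (A i) x)" by auto
  show "(\<integral>x. (\<Sum>i\<in>I. t i * indicator (A i) x) \<partial>\<mu>) = (\<Sum>i\<in>I. t i * measure \<mu> (A i))"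
    using i finite_borel_measuresD(3)[OF \<mu>] by (subst Bochner_Integration.integral_sum) auto
qed

text \<open>A bounded density with bounded support has finite moments, whatever the p-moment of
  \<mu> is.\<close>

lemma density_in_finite_moment_measures:
  fixes g :: "'a::metric_space \<Rightarrow> real"
  assumes \<mu>: "\<mu> \<in> finite_borel_measures" and p: "p \<ge> 0"
    and g: "g \<in> borel_measurable borel" "\<And>x. 0 \<le> g x" "\<And>x. g x \<le> K"
    and R: "\<And>x. g x \<noteq> 0 \<Longrightarrow> dist x x0 \<le> R"
  shows "density \<mu> g \<in> finite_moment_measures p"
proof -
  interpret finite_measure \<mu> using finite_borel_measuresD(1)[OF \<mu>] .
  note s[measurable_cong] = finite_borel_measuresD(2)[OF \<mu>]
  note [measurable] = g(1)
  have [measurable]: "(\<lambda>x. dist x x0) \<in> borel_measurable borel"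
    by (intro borel_measurable_continuous_onI continuous_intros)
  have "(\<integral>\<^sup>+x. ennreal (dist x x0 powr p) \<partial>density \<mu> g) = (\<integral>\<^sup>+x. ennreal (g x) * ennreal (dist x x0 powr p) \<partial>\<mu>)"
    by (rule nn_integral_density) measurable
  also have "\<dots> \<le> (\<integral>\<^sup>+x. ennreal (K * R powr p) \<partial>\<mu>)"
  proof (intro nn_integral_mono)
    fix x
    have "g x * dist x x0 powr p \<le> K * R powr p"
    proof (cases "g x = 0")
      case True
      then show ?thesis using g(2)[of x] g(3)[of x] by simp
    next
      case False
      then show ?thesis using g(2)[of x] g(3)[of x] R[OF False] p by (intro mult_mono powr_mono2) auto
    qed
    then show "ennreal (g x) * ennreal (dist x x0 powr p) \<le> ennreal (K * R powr p)"
      using g(2) by (simp add: ennreal_leI flip: ennreal_mult)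
  qed
  also have "\<dots> < \<infinity>" by (simp add: ennreal_mult_less_top emeasure_eq_measure)
  finally show ?thesis
    using total_variation_density_le(1)[OF \<mu> g] by (auto simp: finite_moment_measures_def)
qed

text \<open>\<mu> is rescaled on each cell so that the cell receives mass \<open>r i\<close>. As its
  shape inside the cell is kept, \<open>1 - g x\<close> is constant there and the cell contributes
  exactly its mass defect to the integral of \<open>\<bar>1 - g x\<bar>\<close>.\<close>

lemma cell_density:
  fixes z :: "'i \<Rightarrow> 'a::metric_space"
  assumes \<mu>: "\<mu> \<in> finite_borel_measures" and p: "p \<ge> 0" and I: "finite I" "disjoint_family_on A I"
    and A: "\<And>i. i \<in> I \<Longrightarrow> A i \<in> sets borel" "\<And>i. i \<in> I \<Longrightarrow> measure \<mu> (A i) > 0"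
    and d: "\<And>i x. i \<in> I \<Longrightarrow> x \<in> A i \<Longrightarrow> dist x (z i) < d" and r: "\<And>i. i \<in> I \<Longrightarrow> r i \<ge> 0"
  defines "g \<equiv> \<lambda>x. \<Sum>i\<in>I. r i / measure \<mu> (A i) * indicator (A i) x"
  shows "density \<mu> g \<in> finite_moment_measures p"
    and "total_variation (signed_diff \<mu> (density \<mu> g))
      \<le> (\<Sum>i\<in>I. \<bar>measure \<mu> (A i) - r i\<bar>) + measure \<mu> (- (\<Union>i\<in>I. A i))"
proof -
  define K where "K = (\<Sum>i\<in>I. r i / measure \<mu> (A i))"
  define U where "U = (\<Union>i\<in>I. A i)"
  have U: "U \<in> sets borel" "- U \<in> sets borel"
    using A(1) I(1) by (auto simp: U_def intro!: borel_comp simp del: Compl_UN)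
  have gm: "g \<in> borel_measurable borel" unfolding g_def using A(1) by measurable
  have g0: "0 \<le> g x" for x unfolding g_def using r A(2) by (intro sum_nonneg) (auto intro!: mult_nonneg_nonneg divide_nonneg_pos)
  have gK: "g x \<le> K" for x
    unfolding g_def K_def using r A(2)
    by (intro sum_mono) (auto simp: indicator_def intro!: divide_nonneg_pos)
  have gU: "g x = 0" if "x \<notin> U" for x using that by (auto simp: g_def U_def intro!: sum.neutral)
  \<comment> \<open>Any base point will do for the moment; \<open>undefined\<close> is simply some
    point of the space. Finitely many cells of radius \<open>d\<close> lie in one ball around
    it.\<close>
  have "dist x undefined \<le> d + (\<Sum>i\<in>I. dist (z i) undefined)" if nz: "g x \<noteq> 0" for x
  proof -
    obtain i where i: "i \<in> I" "x \<in> A i" using gU[of x] nz by (auto simp: U_def)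
    have "dist (z i) undefined \<le> (\<Sum>i\<in>I. dist (z i) undefined)"
      using i I by (intro member_le_sum) auto
    then show ?thesis using d[OF i] dist_triangle[of x undefined "z i"] by linarith
  qed
  then show "density \<mu> g \<in> finite_moment_measures p"
    using density_in_finite_moment_measures[OF \<mu> p gm g0 gK] by blast
  have "\<bar>1 - g x\<bar> = (\<Sum>i\<in>I. \<bar>1 - r i / measure \<mu> (A i)\<bar> * indicator (A i) x) + indicator (- U) x" for x
  proof (cases "x \<in> U")
    case True
    then obtain i where i: "i \<in> I" "x \<in> A i" by (auto simp: U_def)
    then show ?thesis
      unfolding g_def sum_indicator_cells[OF I(2,1) i] using True by simp
  next
    case False
    then have "(\<Sum>i\<in>I. \<bar>1 - r i / measure \<mu> (A i)\<bar> * indicator (A i) x) = 0"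
      by (auto simp: U_def intro!: sum.neutral)
    then show ?thesis using gU False by simp
  qed
  then have "(\<integral>x. \<bar>1 - g x\<bar> \<partial>\<mu>)
      = (\<integral>x. (\<Sum>i\<in>I. \<bar>1 - r i / measure \<mu> (A i)\<bar> * indicator (A i) x) + indicator (- U) x \<partial>\<mu>)"
    by simp
  \<comment> \<open>The set outside the cells is integrated as a family with the single member
    \<open>- U\<close>, indexed by \<open>{()}\<close>.\<close>
  also have "\<dots> = (\<Sum>i\<in>I. \<bar>1 - r i / measure \<mu> (A i)\<bar> * measure \<mu> (A i)) + measure \<mu> (- U)"
    using integral_sum_indicator_cells[where A=A and I=I, OF \<mu> A(1)] integral_sum_indicator_cells[OF \<mu>, of "{()}" "\<lambda>_. - U" "\<lambda>_. 1"] U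
    by (subst Bochner_Integration.integral_add) auto
  also have "(\<Sum>i\<in>I. \<bar>1 - r i / measure \<mu> (A i)\<bar> * measure \<mu> (A i)) = (\<Sum>i\<in>I. \<bar>measure \<mu> (A i) - r i\<bar>)"
  proof (intro sum.cong refl)
    fix i assume "i \<in> I"
    then have *: "measure \<mu> (A i) > 0" using A(2) by simp
    have "\<bar>1 - r i / measure \<mu> (A i)\<bar> * measure \<mu> (A i) = \<bar>(1 - r i / measure \<mu> (A i)) * measure \<mu> (A i)\<bar>"
      by (simp add: abs_mult)
    also have "(1 - r i / measure \<mu> (A i)) * measure \<mu> (A i) = measure \<mu> (A i) - r i"
      using * by (simp add: left_diff_distrib)
    finally show "\<bar>1 - r i / measure \<mu> (A i)\<bar> * measure \<mu> (A i) = \<bar>measure \<mu> (A i) - r i\<bar>" .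
  qed
  finally show "total_variation (signed_diff \<mu> (density \<mu> g))
      \<le> (\<Sum>i\<in>I. \<bar>measure \<mu> (A i) - r i\<bar>) + measure \<mu> (- (\<Union>i\<in>I. A i))"
    using total_variation_density_le(2)[OF \<mu> gm g0 gK] by (simp add: U_def)
qed

text \<open>A lower sum: \<open>f\<close> is replaced by \<open>s i\<close> on the cells and by its
  worst value \<open>- a\<close> on what they leave uncovered.\<close>

lemma integral_ge_cells:
  fixes f :: "'a::topological_space \<Rightarrow> real"
  assumes \<mu>: "\<mu> \<in> finite_borel_measures" and I: "finite I" "disjoint_family_on A I"
    and A: "\<And>i. i \<in> I \<Longrightarrow> A i \<in> sets borel"
    and f: "f \<in> borel_measurable borel" "\<And>x. \<bar>f x\<bar> \<le> a" "\<And>i x. i \<in> I \<Longrightarrow> x \<in> A i \<Longrightarrow> s i \<le> f x"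
  shows "(\<Sum>i\<in>I. s i * measure \<mu> (A i)) - a * measure \<mu> (- (\<Union>i\<in>I. A i)) \<le> (\<integral>x. f x \<partial>\<mu>)"
proof -
  define U where "U = (\<Union>i\<in>I. A i)"
  have U: "U \<in> sets borel" "- U \<in> sets borel"
    using A(1) I(1) by (auto simp: U_def intro!: borel_comp simp del: Compl_UN)
  have i2: "integrable \<mu> (\<lambda>x. a * indicator (- U) x)" "(\<integral>x. a * indicator (- U) x \<partial>\<mu>) = a * measure \<mu> (- U)"
    using integral_sum_indicator_cells[OF \<mu>, of "{()}" "\<lambda>_. - U" "\<lambda>_. a"] U by auto
  note i1 = integral_sum_indicator_cells[where A=A and I=I, OF \<mu> A]
  have "(\<Sum>i\<in>I. s i * measure \<mu> (A i)) - a * measure \<mu> (- U)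
      = (\<integral>x. (\<Sum>i\<in>I. s i * indicator (A i) x) - a * indicator (- U) x \<partial>\<mu>)"
    using i1 i2 by (subst Bochner_Integration.integral_diff) auto
  also have "\<dots> \<le> (\<integral>x. f x \<partial>\<mu>)"
  proof (rule integral_mono)
    show "integrable \<mu> (\<lambda>x. (\<Sum>i\<in>I. s i * indicator (A i) x) - a * indicator (- U) x)"
      using i1(1) i2(1) by (rule Bochner_Integration.integrable_diff)
    show "integrable \<mu> f" by (rule integrable_bounded_borel[OF \<mu> f(1,2)])
    fix x
    show "(\<Sum>i\<in>I. s i * indicator (A i) x) - a * indicator (- U) x \<le> f x"
    proof (cases "x \<in> U")
      case True
      then obtain i where i: "i \<in> I" "x \<in> A i" by (auto simp: U_def)
      then show ?thesis
        unfolding sum_indicator_cells[OF I(2,1) i] using True f(3) by simp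
    next
      case False
      then have "(\<Sum>i\<in>I. s i * indicator (A i) x) = 0" by (auto simp: U_def intro!: sum.neutral)
      then show ?thesis using f(2)[of x] False by (simp add: abs_le_iff)
    qed
  qed
  finally show ?thesis by (simp add: U_def)
qed

section \<open>Couplings with a density with respect to the product measure\<close>

lemma distr_density_pair_measure:
  fixes \<mu> \<nu> :: "'a::second_countable_topology measure"
  assumes \<mu>: "\<mu> \<in> finite_borel_measures" and \<nu>: "\<nu> \<in> finite_borel_measures"
    and h[measurable]: "h \<in> borel_measurable (borel \<Otimes>\<^sub>M borel)"
    and G: "\<And>x. (\<integral>\<^sup>+y. h (x, y) \<partial>\<nu>) = g1 x" "\<And>y. (\<integral>\<^sup>+x. h (x, y) \<partial>\<mu>) = g2 y"
  shows "distr (density (\<mu> \<Otimes>\<^sub>M \<nu>) h) borel fst = density \<mu> g1"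
    and "distr (density (\<mu> \<Otimes>\<^sub>M \<nu>) h) borel snd = density \<nu> g2"
proof -
  interpret f1: finite_measure \<mu> using finite_borel_measuresD(1)[OF \<mu>] .
  interpret f2: finite_measure \<nu> using finite_borel_measuresD(1)[OF \<nu>] .
  interpret pair_sigma_finite \<mu> \<nu> ..
  note s[measurable_cong] = finite_borel_measuresD(2)[OF \<mu>] finite_borel_measuresD(2)[OF \<nu>]
    and sp = finite_borel_measuresD(3)[OF \<mu>] finite_borel_measuresD(3)[OF \<nu>]
  have [measurable]: "g1 \<in> borel_measurable borel" "g2 \<in> borel_measurable borel"
    unfolding G[symmetric] by measurable
  show "distr (density (\<mu> \<Otimes>\<^sub>M \<nu>) h) borel fst = density \<mu> g1"
  proof (rule measure_eqI)
    fix S assume "S \<in> sets (distr (density (\<mu> \<Otimes>\<^sub>M \<nu>) h) borel fst)"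
    then have S[measurable]: "S \<in> sets borel" by simp
    have "emeasure (distr (density (\<mu> \<Otimes>\<^sub>M \<nu>) h) borel fst) S = (\<integral>\<^sup>+x. indicator S x \<partial>distr (density (\<mu> \<Otimes>\<^sub>M \<nu>) h) borel fst)"
      by simp
    also have "\<dots> = (\<integral>\<^sup>+z. h z * indicator S (fst z) \<partial>(\<mu> \<Otimes>\<^sub>M \<nu>))"
      by (subst nn_integral_distr, measurable, subst nn_integral_density, measurable)
    also have "\<dots> = (\<integral>\<^sup>+x. (\<integral>\<^sup>+y. h (x, y) * indicator S x \<partial>\<nu>) \<partial>\<mu>)"
      by (subst f2.nn_integral_fst[symmetric]) auto
    also have "\<dots> = (\<integral>\<^sup>+x. g1 x * indicator S x \<partial>\<mu>)"
      by (simp add: nn_integral_multc G)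
    also have "\<dots> = emeasure (density \<mu> g1) S"
      by (simp add: emeasure_density)
    finally show "emeasure (distr (density (\<mu> \<Otimes>\<^sub>M \<nu>) h) borel fst) S = emeasure (density \<mu> g1) S" .
  qed (simp add: s)
  show "distr (density (\<mu> \<Otimes>\<^sub>M \<nu>) h) borel snd = density \<nu> g2"
  proof (rule measure_eqI)
    fix S assume "S \<in> sets (distr (density (\<mu> \<Otimes>\<^sub>M \<nu>) h) borel snd)"
    then have S[measurable]: "S \<in> sets borel" by simp
    have "emeasure (distr (density (\<mu> \<Otimes>\<^sub>M \<nu>) h) borel snd) S = (\<integral>\<^sup>+x. indicator S x \<partial>distr (density (\<mu> \<Otimes>\<^sub>M \<nu>) h) borel snd)"
      by simp
    also have "\<dots> = (\<integral>\<^sup>+z. h z * indicator S (snd z) \<partial>(\<mu> \<Otimes>\<^sub>M \<nu>))"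
      by (subst nn_integral_distr, measurable, subst nn_integral_density, measurable)
    also have "\<dots> = (\<integral>\<^sup>+y. (\<integral>\<^sup>+x. h (x, y) * indicator S y \<partial>\<mu>) \<partial>\<nu>)"
      by (subst nn_integral_snd[symmetric]) auto
    also have "\<dots> = (\<integral>\<^sup>+y. g2 y * indicator S y \<partial>\<nu>)"
      by (simp add: nn_integral_multc G)
    also have "\<dots> = emeasure (density \<nu> g2) S"
      by (simp add: emeasure_density)
    finally show "emeasure (distr (density (\<mu> \<Otimes>\<^sub>M \<nu>) h) borel snd) S = emeasure (density \<nu> g2) S" .
  qed (simp add: s)
qed

lemma nn_integral_sum_indicator_cells:
  fixes t :: "'i \<Rightarrow> real"
  assumes \<mu>: "\<mu> \<in> finite_borel_measures" and A: "\<And>i. i \<in> I \<Longrightarrow> A i \<in> sets borel" and t: "\<And>i. i \<in> I \<Longrightarrow> t i \<ge> 0"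
  shows "(\<integral>\<^sup>+x. ennreal (\<Sum>i\<in>I. t i * indicator (A i) x) \<partial>\<mu>) = ennreal (\<Sum>i\<in>I. t i * measure \<mu> (A i))"
  using integral_sum_indicator_cells[where A=A and I=I, OF \<mu> A] t
  by (subst nn_integral_eq_integral) (auto intro!: AE_I2 sum_nonneg)

text \<open>Integrates out one variable of a kernel that is constant on products of cells.
  Transposing \<open>w\<close> gives the other variable, so one lemma yields both marginals and the
  cost.\<close>

lemma nn_integral_double_cells:
  fixes w :: "'i \<Rightarrow> 'j \<Rightarrow> real"
  assumes \<mu>: "\<mu> \<in> finite_borel_measures"
    and A: "\<And>i. i \<in> I \<Longrightarrow> A i \<in> sets borel" and w: "\<And>i j. w i j \<ge> 0"
  shows "(\<integral>\<^sup>+x. ennreal (\<Sum>i\<in>I. \<Sum>j\<in>J. w i j * indicator (A i) x * indicator (B j) y) \<partial>\<mu>)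
    = ennreal (\<Sum>j\<in>J. (\<Sum>i\<in>I. w i j * measure \<mu> (A i)) * indicator (B j) y)"
proof -
  have "(\<Sum>i\<in>I. \<Sum>j\<in>J. w i j * indicator (A i) x * indicator (B j) y)
      = (\<Sum>i\<in>I. (\<Sum>j\<in>J. w i j * indicator (B j) y) * indicator (A i) x)" for x
    by (simp add: sum_distrib_left sum_distrib_right ac_simps)
  then have "(\<integral>\<^sup>+x. ennreal (\<Sum>i\<in>I. \<Sum>j\<in>J. w i j * indicator (A i) x * indicator (B j) y) \<partial>\<mu>)
      = ennreal (\<Sum>i\<in>I. (\<Sum>j\<in>J. w i j * indicator (B j) y) * measure \<mu> (A i))"
    using nn_integral_sum_indicator_cells[where A=A and I=I, OF \<mu> A, of "\<lambda>i. \<Sum>j\<in>J. w i j * indicator (B j) y"] w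
    by (simp add: sum_nonneg)
  also have "(\<Sum>i\<in>I. (\<Sum>j\<in>J. w i j * indicator (B j) y) * measure \<mu> (A i))
      = (\<Sum>j\<in>J. (\<Sum>i\<in>I. w i j * measure \<mu> (A i)) * indicator (B j) y)"
    by (simp add: sum_distrib_left sum_distrib_right ac_simps) (rule sum.swap)
  finally show ?thesis .
qed

section \<open>Duality\<close>

lemma measure_compl_UN_cells:
  assumes \<mu>: "\<mu> \<in> finite_borel_measures" and "disjoint_family_on A I" "finite I"
    and A: "\<And>i. i \<in> I \<Longrightarrow> A i \<in> sets borel"
  shows "measure \<mu> (- (\<Union>i\<in>I. A i)) = measure \<mu> UNIV - (\<Sum>i\<in>I. measure \<mu> (A i))"
proof -
  interpret finite_measure \<mu> using finite_borel_measuresD(1)[OF \<mu>] .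
  have "(\<Union>i\<in>I. A i) \<in> sets \<mu>" using A assms(3) finite_borel_measuresD(2)[OF \<mu>] by auto
  then have "measure \<mu> (- (\<Union>i\<in>I. A i)) = measure \<mu> UNIV - measure \<mu> (\<Union>i\<in>I. A i)"
    using finite_measure_compl finite_borel_measuresD(3)[OF \<mu>] by (metis Compl_eq_Diff_UNIV)
  then show ?thesis
    using finite_measure_finite_Union[of I A] assms finite_borel_measuresD(2)[OF \<mu>] by (simp add: image_subset_iff)
qed

text \<open>Above \<open>- a\<close> the function \<open>I_fun\<close> is truncation from above at
  \<open>a\<close>, so only the finite branches occur.\<close>

lemma I_integral_eq:
  assumes "a > 0" "\<And>x. - a \<le> apply_bcontfun \<phi> x"
  shows "I_integral a \<mu> \<phi> = (\<integral>x. min (apply_bcontfun \<phi> x) a \<partial>\<mu>)"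
  unfolding I_integral_def by (intro Bochner_Integration.integral_cong refl real_I_fun assms)

lemma borel_measurable_apply_bcontfun [measurable]:
  fixes \<phi> :: "'a::topological_space \<Rightarrow>\<^sub>C real"
  shows "apply_bcontfun \<phi> \<in> borel_measurable borel"
  by (intro borel_measurable_continuous_onI) (rule continuous_on_apply_bcontfun)

text \<open>Truncating both potentials at \<open>a\<close> keeps the constraint and makes them
  bounded by \<open>a\<close> in modulus. Each mass penalty then pays for the change of measure, and
  the transport term pays for the constraint between the new measures.\<close>

lemma weak_duality:
  fixes \<mu> \<nu> :: "'a::{metric_space, second_countable_topology} measure"
  assumes a: "a > 0" and b: "b > 0" and p: "p > 0"
    and \<mu>: "\<mu> \<in> finite_borel_measures" and \<nu>: "\<nu> \<in> finite_borel_measures"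
    and \<mu>1: "\<mu>1 \<in> finite_moment_measures p" and \<mu>2: "\<mu>2 \<in> finite_moment_measures p"
    and M: "measure \<mu>1 UNIV = measure \<mu>2 UNIV" and \<phi>: "(\<phi>1, \<phi>2) \<in> Phi_W a b p"
  shows "I_integral a \<mu> \<phi>1 + I_integral a \<nu> \<phi>2
    \<le> a * total_variation (signed_diff \<mu> \<mu>1) + a * total_variation (signed_diff \<nu> \<mu>2)
      + b powr p * wasserstein p \<mu>1 \<mu>2 powr p"
proof -
  define f where "f x = min (apply_bcontfun \<phi>1 x) a" for x
  define g where "g x = min (apply_bcontfun \<phi>2 x) a" for x
  have \<phi>a: "- a \<le> apply_bcontfun \<phi>1 x" "- a \<le> apply_bcontfun \<phi>2 x" for x using \<phi> by (auto simp: Phi_W_def)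
  have f: "f \<in> borel_measurable borel" "\<bar>f x\<bar> \<le> a" and g: "g \<in> borel_measurable borel" "\<bar>g x\<bar> \<le> a" for x
    using \<phi>a[of x] a unfolding f_def[abs_def] g_def[abs_def] by (auto simp: abs_le_iff)
  have "f x + g y \<le> (b * dist x y) powr p" for x y
  proof -
    have "apply_bcontfun \<phi>1 x + apply_bcontfun \<phi>2 y \<le> (b * dist x y) powr p" using \<phi> by (simp add: Phi_W_def)
    then show ?thesis unfolding f_def g_def by linarith
  qed
  then have "(\<integral>x. f x \<partial>\<mu>1) + (\<integral>x. g x \<partial>\<mu>2) \<le> b powr p * wasserstein p \<mu>1 \<mu>2 powr p"
    by (intro wasserstein_weak_duality[OF p b \<mu>1 \<mu>2 M f g])
  moreover have "(\<integral>x. f x \<partial>\<mu>) - (\<integral>x. f x \<partial>\<mu>1) \<le> a * total_variation (signed_diff \<mu> \<mu>1)"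
    by (intro integral_diff_le_total_variation[OF \<mu> finite_moment_measuresD[OF \<mu>1] f])
  moreover have "(\<integral>x. g x \<partial>\<nu>) - (\<integral>x. g x \<partial>\<mu>2) \<le> a * total_variation (signed_diff \<nu> \<mu>2)"
    by (intro integral_diff_le_total_variation[OF \<nu> finite_moment_measuresD[OF \<mu>2] g])
  ultimately show ?thesis
    using I_integral_eq[OF a \<phi>a(1), of \<mu>] I_integral_eq[OF a \<phi>a(2), of \<nu>] by (simp flip: f_def g_def)
qed

lemma approx_strong_duality:
  fixes \<mu> \<nu> :: "'a::{metric_space, second_countable_topology} measure"
  assumes a: "a > 0" and b: "b > 0" and p: "p > 0" and e0: "e0 > 0"
    and \<mu>: "\<mu> \<in> finite_borel_measures" and \<nu>: "\<nu> \<in> finite_borel_measures"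
  obtains \<mu>1 \<mu>2 \<phi>1 \<phi>2 where "\<mu>1 \<in> finite_moment_measures p" "\<mu>2 \<in> finite_moment_measures p"
    "measure \<mu>1 UNIV = measure \<mu>2 UNIV" "(\<phi>1, \<phi>2) \<in> Phi_W a b p"
    "a * total_variation (signed_diff \<mu> \<mu>1) + a * total_variation (signed_diff \<nu> \<mu>2)
      + b powr p * wasserstein p \<mu>1 \<mu>2 powr p \<le> I_integral a \<mu> \<phi>1 + I_integral a \<nu> \<phi>2 + e0"
proof -
  interpret f1: finite_measure \<mu> using finite_borel_measuresD(1)[OF \<mu>] .
  interpret f2: finite_measure \<nu> using finite_borel_measuresD(1)[OF \<nu>] .
  interpret pair_sigma_finite \<mu> \<nu> ..
  note s[measurable_cong] = finite_borel_measuresD(2)[OF \<mu>] finite_borel_measuresD(2)[OF \<nu>]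
    and sp = finite_borel_measuresD(3)[OF \<mu>] finite_borel_measuresD(3)[OF \<nu>]
  define M where "M = measure \<mu> UNIV"
  define N where "N = measure \<nu> UNIV"
  have MN: "M \<ge> 0" "N \<ge> 0" by (auto simp: M_def N_def)
  \<comment> \<open>The error budget in multiples of \<open>e\<close>: 1 from the finite duality,
    \<open>4 * a\<close> from the mass outside the cells (once per measure on the primal and once on
    the dual side), and 3 and 1 times the masses \<open>M\<close> and \<open>N\<close> from the
    extended potentials, rounded up to 3 for both.\<close>
  define C where "C = 1 + 4 * a + 3 * (M + N)"
  have C: "C > 0" using a MN by (simp add: C_def add_pos_nonneg)
  define e where "e = min (1/2) (e0 / C)"
  have e: "e > 0" "e \<le> 1/2" "e * C \<le> e0" using e0 C by (auto simp: e_def min_def field_simps)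
  define T where "T = 2 * a + 1"
  have T: "T \<ge> 0" using a by (simp add: T_def)
  define q where "q t = min ((b * t) powr p) T" for t
  obtain d where d: "d > 0"
    "\<And>s t. 0 \<le> s \<Longrightarrow> 0 \<le> t \<Longrightarrow> \<bar>s - t\<bar> < d \<Longrightarrow> \<bar>q s - q t\<bar> \<le> e"
    unfolding q_def using truncated_powr_modulus[OF p b T e(1)] by blast
  \<comment> \<open>Radius \<open>d / 2\<close> is chosen because both endpoints of a pair move:
    replacing them by their centres changes the distance by less than \<open>d\<close>.\<close>
  obtain A and z :: "nat \<Rightarrow> 'a" and n where A: "disjoint_family A" "\<And>i. A i \<in> sets borel"
    and z: "\<And>i x. x \<in> A i \<Longrightarrow> dist x (z i) < d / 2"
    and small: "measure \<mu> (- (\<Union>i<n. A i)) < e" "measure \<nu> (- (\<Union>i<n. A i)) < e"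
    by (rule fine_partition[OF \<mu> \<nu> half_gt_zero[OF d(1)] e(1)]) blast
  have dj: "disjoint_family_on A S" for S using A(1) by (auto simp: disjoint_family_on_def)
  \<comment> \<open>Null cells are dropped so that the densities below divide by positive masses;
    the covered mass stays the same.\<close>
  define I where "I = {i \<in> {..<n}. measure \<mu> (A i) > 0}"
  define J where "J = {i \<in> {..<n}. measure \<nu> (A i) > 0}"
  have fin: "finite I" "finite J" by (auto simp: I_def J_def)
  have "(\<Sum>i\<in>I. measure \<mu> (A i)) = (\<Sum>i<n. measure \<mu> (A i))" "(\<Sum>i\<in>J. measure \<nu> (A i)) = (\<Sum>i<n. measure \<nu> (A i))"
    by (auto simp: I_def J_def less_le intro!: sum.mono_neutral_left)
  then have rest: "measure \<mu> (- (\<Union>i\<in>I. A i)) < e" "measure \<nu> (- (\<Union>i\<in>J. A i)) < e"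
    using small measure_compl_UN_cells[OF \<mu> dj fin(1) A(2)] measure_compl_UN_cells[OF \<nu> dj fin(2) A(2)]
      measure_compl_UN_cells[OF \<mu> dj _ A(2), of "{..<n}"] measure_compl_UN_cells[OF \<nu> dj _ A(2), of "{..<n}"] by auto
  have total: "(\<Sum>i\<in>I. measure \<mu> (A i)) \<le> M" "(\<Sum>i\<in>J. measure \<nu> (A i)) \<le> N"
    using measure_compl_UN_cells[OF \<mu> dj fin(1) A(2)] measure_compl_UN_cells[OF \<nu> dj fin(2) A(2)]
      measure_nonneg[of \<mu> "- (\<Union>i\<in>I. A i)"] measure_nonneg[of \<nu> "- (\<Union>i\<in>J. A i)"]
    unfolding M_def N_def by linarith+
  \<comment> \<open>Adding \<open>e\<close> makes \<open>c i j\<close> bound the true cost on all of \<open>A i \<times> A j\<close> when \<open>c i j < 2 * a\<close>, i.e. wherever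
    the plan has mass: the truncation at \<open>T > 2 * a\<close> is then inactive.\<close>
  define c where "c i j = q (dist (z i) (z j)) + e" for i j
  have q0: "q t \<ge> 0" for t using T by (simp add: q_def)
  have c0: "c i j \<ge> 0" for i j using q0[of "dist (z i) (z j)"] e(1) by (simp add: c_def)
  obtain u v \<pi> where u: "\<And>i. i \<in> I \<Longrightarrow> \<bar>u i\<bar> \<le> a" and v: "\<And>j. j \<in> J \<Longrightarrow> \<bar>v j\<bar> \<le> a"
    and uv: "\<And>i j. i \<in> I \<Longrightarrow> j \<in> J \<Longrightarrow> u i + v j \<le> c i j + e"
    and \<pi>: "\<And>i j. \<pi> i j \<ge> 0" "\<And>i j. i \<in> I \<Longrightarrow> j \<in> J \<Longrightarrow> \<pi> i j > 0 \<Longrightarrow> c i j < 2 * a"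
    and LP: "a * (\<Sum>i\<in>I. \<bar>measure \<mu> (A i) - (\<Sum>j\<in>J. \<pi> i j)\<bar>) + a * (\<Sum>j\<in>J. \<bar>measure \<nu> (A j) - (\<Sum>i\<in>I. \<pi> i j)\<bar>)
       + (\<Sum>i\<in>I. \<Sum>j\<in>J. c i j * \<pi> i j)
     \<le> (\<Sum>i\<in>I. u i * measure \<mu> (A i)) + (\<Sum>j\<in>J. v j * measure \<nu> (A j)) + e"
    by (rule finite_approx_duality[OF fin a e(1), of "\<lambda>i. measure \<mu> (A i)" "\<lambda>j. measure \<nu> (A j)" c,
          OF measure_nonneg measure_nonneg c0]) blast
  have e2: "0 \<le> 2 * e" "0 \<le> e" using e(1) by auto
  \<comment> \<open>The slack doubles: one \<open>e\<close> was added to the cost in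
    \<open>c\<close>, the other comes from the finite duality.\<close>
  have uv': "u i + v j \<le> min ((b * dist (z i) (z j)) powr p) T + 2 * e" if "i \<in> I" "j \<in> J" for i j
    using uv[OF that] by (simp add: c_def q_def)
  obtain \<phi>1 \<phi>2 where \<phi>: "(\<phi>1, \<phi>2) \<in> Phi_W a b p"
    and \<phi>1: "\<And>i x. i \<in> I \<Longrightarrow> dist x (z i) < d \<Longrightarrow> u i - 2 * e - e \<le> min (apply_bcontfun \<phi>1 x) a"
    and \<phi>2: "\<And>j y. j \<in> J \<Longrightarrow> dist y (z j) < d \<Longrightarrow> v j - e \<le> min (apply_bcontfun \<phi>2 y) a"
    by (rule Phi_W_extension[where I=I and J=J and z=z and u=u and v=v and \<kappa>="2 * e" and d=d,
          OF a b p T e2 u v uv' d(2)[unfolded q_def]]) (assumption | (rule that, assumption, simp, simp))+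
  have \<phi>a: "- a \<le> apply_bcontfun \<phi>1 x" "- a \<le> apply_bcontfun \<phi>2 x" for x using \<phi> by (auto simp: Phi_W_def)
  have zd: "dist x (z i) < d" if "x \<in> A i" for x i using z[OF that] d(1) by simp
  have "(\<Sum>i\<in>I. (u i - 3 * e) * measure \<mu> (A i)) - a * measure \<mu> (- (\<Union>i\<in>I. A i))
      \<le> (\<integral>x. min (apply_bcontfun \<phi>1 x) a \<partial>\<mu>)"
    using \<phi>1[OF _ zd] \<phi>a(1) a A(2) by (intro integral_ge_cells[OF \<mu> fin(1) dj]) (auto simp: abs_le_iff minus_le_iff)
  also have "\<dots> = I_integral a \<mu> \<phi>1" by (rule I_integral_eq[OF a \<phi>a(1), symmetric])
  finally have d1: "(\<Sum>i\<in>I. u i * measure \<mu> (A i)) - 3 * e * (\<Sum>i\<in>I. measure \<mu> (A i)) - a * measure \<mu> (- (\<Union>i\<in>I. A i))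
      \<le> I_integral a \<mu> \<phi>1"
    by (simp add: left_diff_distrib sum_subtractf sum_distrib_left)
  have "(\<Sum>i\<in>J. (v i - e) * measure \<nu> (A i)) - a * measure \<nu> (- (\<Union>i\<in>J. A i))
      \<le> (\<integral>x. min (apply_bcontfun \<phi>2 x) a \<partial>\<nu>)"
    using \<phi>2[OF _ zd] \<phi>a(2) a A(2) by (intro integral_ge_cells[OF \<nu> fin(2) dj]) (auto simp: abs_le_iff minus_le_iff)
  also have "\<dots> = I_integral a \<nu> \<phi>2" by (rule I_integral_eq[OF a \<phi>a(2), symmetric])
  finally have d2: "(\<Sum>i\<in>J. v i * measure \<nu> (A i)) - e * (\<Sum>i\<in>J. measure \<nu> (A i)) - a * measure \<nu> (- (\<Union>i\<in>J. A i))
      \<le> I_integral a \<nu> \<phi>2"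
    by (simp add: left_diff_distrib sum_subtractf sum_distrib_left)
  \<comment> \<open>The height of the density on \<open>A i \<times> A j\<close>: times the product
    mass of this rectangle it gives \<open>\<pi> i j\<close>.\<close>
  define w where "w i j = \<pi> i j / (measure \<mu> (A i) * measure \<nu> (A j))" for i j
  have w0: "w i j \<ge> 0" for i j using \<pi>(1) by (simp add: w_def)
  define h where "h = (\<lambda>z. ennreal (\<Sum>i\<in>I. \<Sum>j\<in>J. w i j * indicator (A i) (fst z) * indicator (A j) (snd z)))"
  have [measurable]: "h \<in> borel_measurable (borel \<Otimes>\<^sub>M borel)"
    unfolding h_def using A(2) by measurable
  define g1 where "g1 x = (\<Sum>i\<in>I. (\<Sum>j\<in>J. \<pi> i j) / measure \<mu> (A i) * indicator (A i) x)" for x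
  define g2 where "g2 y = (\<Sum>j\<in>J. (\<Sum>i\<in>I. \<pi> i j) / measure \<nu> (A j) * indicator (A j) y)" for y
  have pos: "i \<in> I \<Longrightarrow> measure \<mu> (A i) > 0" "j \<in> J \<Longrightarrow> measure \<nu> (A j) > 0" for i j by (auto simp: I_def J_def)
  have w1: "(\<Sum>i\<in>I. w i j * measure \<mu> (A i)) = (\<Sum>i\<in>I. \<pi> i j) / measure \<nu> (A j)" for j
    unfolding sum_divide_distrib by (intro sum.cong refl) (use pos(1) in \<open>force simp: w_def\<close>)
  have w2: "(\<Sum>j\<in>J. w i j * measure \<nu> (A j)) = (\<Sum>j\<in>J. \<pi> i j) / measure \<mu> (A i)" for i
    unfolding sum_divide_distrib by (intro sum.cong refl) (use pos(2) in \<open>force simp: w_def\<close>)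
  have G2: "(\<integral>\<^sup>+x. h (x, y) \<partial>\<mu>) = ennreal (g2 y)" for y
    using nn_integral_double_cells[where I=I and A=A and B=A and J=J and w=w and y=y, OF \<mu> A(2) w0]
    by (simp add: h_def g2_def w1)
  have G1: "(\<integral>\<^sup>+y. h (x, y) \<partial>\<nu>) = ennreal (g1 x)" for x
  proof -
    have "h (x, y) = ennreal (\<Sum>j\<in>J. \<Sum>i\<in>I. w i j * indicator (A j) y * indicator (A i) x)" for y
      unfolding h_def by (subst sum.swap) (simp add: ac_simps)
    then show ?thesis
      using nn_integral_double_cells[where I=J and A=A and B=A and J=I and w="\<lambda>j i. w i j" and y=x, OF \<nu> A(2) w0]
      by (simp add: g1_def w2)
  qed
  define \<gamma> where "\<gamma> = density (\<mu> \<Otimes>\<^sub>M \<nu>) h"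
  note distr = distr_density_pair_measure[OF \<mu> \<nu> _ G1 G2, folded \<gamma>_def]
  have r0: "(\<Sum>j\<in>J. \<pi> i j) \<ge> 0" "(\<Sum>j\<in>I. \<pi> j i) \<ge> 0" for i using \<pi>(1) by (simp_all add: sum_nonneg)
  have m1: "density \<mu> (\<lambda>x. ennreal (g1 x)) \<in> finite_moment_measures p"
    and t1: "total_variation (signed_diff \<mu> (density \<mu> (\<lambda>x. ennreal (g1 x))))
      \<le> (\<Sum>i\<in>I. \<bar>measure \<mu> (A i) - (\<Sum>j\<in>J. \<pi> i j)\<bar>) + measure \<mu> (- (\<Union>i\<in>I. A i))"
    unfolding g1_def
    by (rule cell_density[where A=A and I=I and z=z and d=d and r="\<lambda>i. \<Sum>j\<in>J. \<pi> i j" and p=p,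
          OF \<mu> less_imp_le[OF p] fin(1) dj A(2) pos(1) zd r0(1)] | assumption)+
  have m2: "density \<nu> (\<lambda>x. ennreal (g2 x)) \<in> finite_moment_measures p"
    and t2: "total_variation (signed_diff \<nu> (density \<nu> (\<lambda>x. ennreal (g2 x))))
      \<le> (\<Sum>j\<in>J. \<bar>measure \<nu> (A j) - (\<Sum>i\<in>I. \<pi> i j)\<bar>) + measure \<nu> (- (\<Union>i\<in>J. A i))"
    unfolding g2_def
    by (rule cell_density[where A=A and I=J and z=z and d=d and r="\<lambda>j. \<Sum>i\<in>I. \<pi> i j" and p=p,
          OF \<nu> less_imp_le[OF p] fin(2) dj A(2) pos(2) zd r0(2)] | assumption)+
  have s\<gamma>: "sets \<gamma> = sets (borel \<Otimes>\<^sub>M borel)"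
    unfolding \<gamma>_def sets_density by (rule sets_pair_measure_cong) (auto simp: s)
  note [measurable_cong] = s\<gamma>
  have sp\<gamma>: "space \<gamma> = UNIV" using sets_eq_imp_space_eq[OF s\<gamma>] by (simp add: space_pair_measure)
  \<comment> \<open>The two competitors have equal mass because both are marginals of
    \<gamma>.\<close>
  have mass1: "emeasure \<gamma> UNIV = emeasure (density \<mu> (\<lambda>x. ennreal (g1 x))) UNIV"
    unfolding distr(1)[symmetric, simplified] by (subst emeasure_distr) (auto simp: sp\<gamma>)
  have mass2: "emeasure \<gamma> UNIV = emeasure (density \<nu> (\<lambda>x. ennreal (g2 x))) UNIV"
    unfolding distr(2)[symmetric, simplified] by (subst emeasure_distr) (auto simp: sp\<gamma>)
  have "emeasure \<gamma> UNIV \<noteq> \<infinity>"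
    unfolding mass1 using finite_measure.emeasure_finite[OF finite_borel_measuresD(1)[OF finite_moment_measuresD[OF m1]]] by simp
  then have \<gamma>: "\<gamma> \<in> finite_borel_measures"
    using s\<gamma> unfolding borel_prod by (auto simp: finite_borel_measures_def sp\<gamma> intro!: finite_measureI)
  have cost: "(b * dist x y) powr p \<le> c i j"
    if "i \<in> I" "j \<in> J" "\<pi> i j > 0" "x \<in> A i" "y \<in> A j" for i j x y
  proof -
    have "\<bar>dist x y - dist (z i) (z j)\<bar> \<le> dist x (z i) + dist y (z j)"
      by (smt (verit) dist_commute dist_triangle)
    also have "\<dots> < d" using z[OF that(4)] z[OF that(5)] by simp
    finally have *: "q (dist x y) \<le> c i j" using d(2)[of "dist x y" "dist (z i) (z j)"] by (simp add: c_def abs_le_iff)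
    also have "\<dots> < T" using \<pi>(2)[OF that(1-3)] by (simp add: T_def)
    finally show ?thesis using * by (simp add: q_def min_def split: if_splits)
  qed
  \<comment> \<open>On a charged rectangle the scaled cost is at most \<open>c i j\<close>. Division
    by \<open>b powr p\<close> converts this to the unscaled cost that \<open>wasserstein\<close>
    uses.\<close>
  define w' where "w' i j = c i j * w i j / b powr p" for i j
  have w'0: "w' i j \<ge> 0" for i j using c0 w0 by (simp add: w'_def)
  have "(\<integral>\<^sup>+(x, y). ennreal (dist x y powr p) \<partial>\<gamma>) = (\<integral>\<^sup>+z. h z * ennreal (dist (fst z) (snd z) powr p) \<partial>(\<mu> \<Otimes>\<^sub>M \<nu>))"
    unfolding \<gamma>_def split_def by (rule nn_integral_density) measurable
  also have "\<dots> \<le> (\<integral>\<^sup>+z. ennreal (\<Sum>i\<in>I. \<Sum>j\<in>J. w' i j * indicator (A i) (fst z) * indicator (A j) (snd z)) \<partial>(\<mu> \<Otimes>\<^sub>M \<nu>))"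
  proof (rule nn_integral_mono)
    fix z :: "'a \<times> 'a"
    define t where "t = dist (fst z) (snd z) powr p"
    have "(w i j * indicator (A i) (fst z) * indicator (A j) (snd z)) * t
        \<le> w' i j * indicator (A i) (fst z) * indicator (A j) (snd z)" if "i \<in> I" "j \<in> J" for i j
    proof (cases "\<pi> i j > 0 \<and> fst z \<in> A i \<and> snd z \<in> A j")
      case True
      then have "b powr p * t \<le> c i j"
        using cost[OF that, of "fst z" "snd z"] b by (simp add: t_def powr_mult)
      then have "t \<le> c i j / b powr p" using b by (simp add: field_simps)
      then have "w i j * t \<le> w i j * (c i j / b powr p)" using w0 by (intro mult_left_mono)
      then show ?thesis using True by (simp add: w'_def mult.commute)
    next
      case False
      then have "w i j * indicator (A i) (fst z) * indicator (A j) (snd z) = 0"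
        using \<pi>(1)[of i j] by (auto simp: w_def less_le)
      then have "w i j * indicator (A i) (fst z) * indicator (A j) (snd z) * t = 0" by (simp only: mult_zero_left)
      also have "0 \<le> w' i j * indicator (A i) (fst z) * indicator (A j) (snd z)"
        by (intro mult_nonneg_nonneg w'0) auto
      finally show ?thesis .
    qed
    then have "(\<Sum>i\<in>I. \<Sum>j\<in>J. w i j * indicator (A i) (fst z) * indicator (A j) (snd z)) * t
        \<le> (\<Sum>i\<in>I. \<Sum>j\<in>J. w' i j * indicator (A i) (fst z) * indicator (A j) (snd z))"
      unfolding sum_distrib_right by (intro sum_mono) auto
    then show "h z * ennreal (dist (fst z) (snd z) powr p)
        \<le> ennreal (\<Sum>i\<in>I. \<Sum>j\<in>J. w' i j * indicator (A i) (fst z) * indicator (A j) (snd z))"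
      using w0 unfolding h_def t_def by (subst ennreal_mult[symmetric]) (auto intro!: sum_nonneg ennreal_leI)
  qed
  also have "\<dots> = (\<integral>\<^sup>+y. \<integral>\<^sup>+x. ennreal (\<Sum>i\<in>I. \<Sum>j\<in>J. w' i j * indicator (A i) x * indicator (A j) y) \<partial>\<mu> \<partial>\<nu>)"
    using A(2) by (subst nn_integral_snd[symmetric]) auto
  also have "\<dots> = (\<integral>\<^sup>+y. ennreal (\<Sum>j\<in>J. (\<Sum>i\<in>I. w' i j * measure \<mu> (A i)) * indicator (A j) y) \<partial>\<nu>)"
    by (subst nn_integral_double_cells[OF \<mu> A(2) w'0]) simp
  also have "\<dots> = ennreal (\<Sum>j\<in>J. (\<Sum>i\<in>I. w' i j * measure \<mu> (A i)) * measure \<nu> (A j))"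
    using A(2) w'0 by (intro nn_integral_sum_indicator_cells[OF \<nu>]) (auto intro!: sum_nonneg)
  also have "(\<Sum>j\<in>J. (\<Sum>i\<in>I. w' i j * measure \<mu> (A i)) * measure \<nu> (A j)) = (\<Sum>i\<in>I. \<Sum>j\<in>J. c i j * \<pi> i j) / b powr p"
    unfolding sum_distrib_right sum_divide_distrib
  proof (subst sum.swap, intro sum.cong refl)
    fix i j assume "i \<in> I" "j \<in> J"
    then show "w' i j * measure \<mu> (A i) * measure \<nu> (A j) = c i j * \<pi> i j / b powr p"
      using pos(1)[of i] pos(2)[of j] by (simp add: w'_def w_def)
  qed
  finally have "wasserstein p (distr \<gamma> borel fst) (distr \<gamma> borel snd) powr p \<le> (\<Sum>i\<in>I. \<Sum>j\<in>J. c i j * \<pi> i j) / b powr p"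
    using c0 \<pi>(1) by (intro wasserstein_distr_le[OF p \<gamma>]) (auto intro!: sum_nonneg divide_nonneg_nonneg)
  then have W: "b powr p * wasserstein p (density \<mu> (\<lambda>x. ennreal (g1 x))) (density \<nu> (\<lambda>x. ennreal (g2 x))) powr p
      \<le> (\<Sum>i\<in>I. \<Sum>j\<in>J. c i j * \<pi> i j)"
    using b distr by (simp add: field_simps)
  show ?thesis
  proof (rule that[OF m1 m2 _ \<phi>])
    show "measure (density \<mu> (\<lambda>x. ennreal (g1 x))) UNIV = measure (density \<nu> (\<lambda>x. ennreal (g2 x))) UNIV"
      using mass1 mass2 by (simp add: measure_def)
    have "a * total_variation (signed_diff \<mu> (density \<mu> (\<lambda>x. ennreal (g1 x))))
        \<le> a * (\<Sum>i\<in>I. \<bar>measure \<mu> (A i) - (\<Sum>j\<in>J. \<pi> i j)\<bar>) + a * measure \<mu> (- (\<Union>i\<in>I. A i))"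
      using mult_left_mono[OF t1, of a] a by (simp add: distrib_left)
    moreover have "a * total_variation (signed_diff \<nu> (density \<nu> (\<lambda>x. ennreal (g2 x))))
        \<le> a * (\<Sum>j\<in>J. \<bar>measure \<nu> (A j) - (\<Sum>i\<in>I. \<pi> i j)\<bar>) + a * measure \<nu> (- (\<Union>i\<in>J. A i))"
      using mult_left_mono[OF t2, of a] a by (simp add: distrib_left)
    moreover have "a * measure \<mu> (- (\<Union>i\<in>I. A i)) \<le> a * e" "a * measure \<nu> (- (\<Union>i\<in>J. A i)) \<le> a * e"
      using rest a by (auto intro!: mult_left_mono)
    moreover have "e * (\<Sum>i\<in>I. measure \<mu> (A i)) \<le> e * M" "e * (\<Sum>i\<in>J. measure \<nu> (A i)) \<le> e * N"
      using total e(1) by (auto intro!: mult_left_mono)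
    moreover have "e + 4 * (a * e) + 3 * (e * M) + e * N \<le> e0"
    proof -
      have "e * C = e + 4 * (a * e) + 3 * (e * M) + 3 * (e * N)" by (simp add: C_def algebra_simps)
      moreover have "0 \<le> e * N" using e(1) MN by simp
      ultimately show ?thesis using e(3) by linarith
    qed
    ultimately show "a * total_variation (signed_diff \<mu> (density \<mu> (\<lambda>x. ennreal (g1 x))))
        + a * total_variation (signed_diff \<nu> (density \<nu> (\<lambda>x. ennreal (g2 x))))
        + b powr p * wasserstein p (density \<mu> (\<lambda>x. ennreal (g1 x))) (density \<nu> (\<lambda>x. ennreal (g2 x))) powr p
        \<le> I_integral a \<mu> \<phi>1 + I_integral a \<nu> \<phi>2 + e0"
      using W LP d1 d2 by linarith
  qed
qed

section \<open>The case p = 1: Lipschitz potentials\<close>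

lemma F_class_iff:
  assumes "b > 0"
  shows "f \<in> F_class a b \<longleftrightarrow> (\<forall>x. \<bar>apply_bcontfun f x\<bar> \<le> a) \<and>
    (\<forall>x y. \<bar>apply_bcontfun f x - apply_bcontfun f y\<bar> \<le> b * dist x y)"
proof -
  have "norm f \<le> a \<longleftrightarrow> (\<forall>x. \<bar>apply_bcontfun f x\<bar> \<le> a)"
    by (metis norm_bound norm_bounded order_trans real_norm_def)
  moreover have "lip_norm (apply_bcontfun f) \<le> ennreal b \<longleftrightarrow>
      (\<forall>x y. x \<noteq> y \<longrightarrow> \<bar>apply_bcontfun f x - apply_bcontfun f y\<bar> / dist x y \<le> b)"
    using assms by (auto simp: lip_norm_def SUP_le_iff)
  moreover have "(x \<noteq> y \<longrightarrow> \<bar>apply_bcontfun f x - apply_bcontfun f y\<bar> / dist x y \<le> b) \<longleftrightarrow>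
      \<bar>apply_bcontfun f x - apply_bcontfun f y\<bar> \<le> b * dist x y" for x y
    by (cases "x = y") (simp_all add: divide_le_eq)
  ultimately show ?thesis unfolding F_class_def by (simp only: mem_Collect_eq)
qed

text \<open>Both \<open>f\<close> and \<open>- f\<close> take values between \<open>- a\<close> and
  \<open>a\<close>, where \<open>I_fun\<close> is the identity, and the Lipschitz bound is exactly
  the constraint for the pair \<open>(f, - f)\<close>.\<close>

lemma signed_integral_F_class:
  assumes a: "a > 0" and b: "b > 0" and \<mu>: "\<mu> \<in> finite_borel_measures" and \<nu>: "\<nu> \<in> finite_borel_measures"
    and f: "f \<in> F_class a b"
  shows "signed_integral (signed_diff \<mu> \<nu>) (apply_bcontfun f) = I_integral a \<mu> f + I_integral a \<nu> (- f)"
    and "(f, - f) \<in> Phi_W a b 1"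
proof -
  note F = f[unfolded F_class_iff[OF b]]
  have fa: "- a \<le> apply_bcontfun f x" "apply_bcontfun f x \<le> a" for x using F by (auto simp: abs_le_iff minus_le_iff)
  have "signed_integral (signed_diff \<mu> \<nu>) (apply_bcontfun f) = (\<integral>x. apply_bcontfun f x \<partial>\<mu>) - (\<integral>x. apply_bcontfun f x \<partial>\<nu>)"
    using F by (intro signed_integral_signed_diff[OF \<mu> \<nu>, of _ a]) auto
  moreover have "I_integral a \<mu> f = (\<integral>x. apply_bcontfun f x \<partial>\<mu>)"
    using fa by (subst I_integral_eq[OF a]) (auto simp: min_absorb1)
  moreover have "I_integral a \<nu> (- f) = - (\<integral>x. apply_bcontfun f x \<partial>\<nu>)"
  proof -
    have "min (apply_bcontfun (- f) x) a = - apply_bcontfun f x" for x using fa(1)[of x] by (simp add: minus_le_iff)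
    then show ?thesis using fa(2) by (subst I_integral_eq[OF a]) auto
  qed
  ultimately show "signed_integral (signed_diff \<mu> \<nu>) (apply_bcontfun f) = I_integral a \<mu> f + I_integral a \<nu> (- f)"
    by simp
  have "apply_bcontfun f x - apply_bcontfun f y \<le> (b * dist x y) powr 1" for x y
    using F b by (simp add: abs_le_iff)
  then show "(f, - f) \<in> Phi_W a b 1" using fa by (simp add: Phi_W_def)
qed

text \<open>The transform \<open>g\<close> lies between the truncated potentials \<phi> and
  \<open>- \<psi>\<close>: above \<phi> by the constraint, below \<open>- \<psi>\<close> by choosing
  \<open>y = x\<close>, where the cost vanishes. It is Lipschitz because for p = 1 the cost
  \<open>b * dist x y\<close> obeys the triangle inequality. Passing to \<open>g\<close> and
  \<open>- g\<close> therefore lowers neither integral.\<close>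

lemma F_class_dominates_Phi_W:
  assumes a: "a > 0" and b: "b > 0" and \<mu>: "\<mu> \<in> finite_borel_measures" and \<nu>: "\<nu> \<in> finite_borel_measures"
    and \<phi>: "(\<phi>1, \<phi>2) \<in> Phi_W a b 1"
  obtains f where "f \<in> F_class a b"
    "I_integral a \<mu> \<phi>1 + I_integral a \<nu> \<phi>2 \<le> signed_integral (signed_diff \<mu> \<nu>) (apply_bcontfun f)"
proof -
  have \<phi>a: "- a \<le> apply_bcontfun \<phi>1 x" "- a \<le> apply_bcontfun \<phi>2 x" for x using \<phi> by (auto simp: Phi_W_def)
  have sum: "apply_bcontfun \<phi>1 x + apply_bcontfun \<phi>2 y \<le> b * dist x y" for x y
    using \<phi> b by (simp add: Phi_W_def)
  define \<phi> where "\<phi> x = min (apply_bcontfun \<phi>1 x) a" for x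
  define \<psi> where "\<psi> x = min (apply_bcontfun \<phi>2 x) a" for x
  have \<phi>b: "\<bar>\<phi> x\<bar> \<le> a" and \<psi>b: "\<bar>\<psi> x\<bar> \<le> a" for x
    using \<phi>a[of x] a by (auto simp: \<phi>_def \<psi>_def abs_le_iff)
  have le: "\<phi> x \<le> b * dist x y - \<psi> y" for x y
    using sum[of x y] unfolding \<phi>_def \<psi>_def by linarith
  define g where "g x = (INF y. b * dist x y - \<psi> y)" for x
  have "- a \<le> b * dist x y - \<psi> y" for x y using le[of x y] \<phi>b[of x] by (simp add: abs_le_iff)
  note lower = this
  have bd: "bdd_below (range (\<lambda>y. b * dist x y - \<psi> y))" for x by (rule bdd_belowI2) (rule lower)
  have g\<psi>: "g x \<le> - \<psi> x" for x unfolding g_def by (rule cINF_lower2[OF bd, of x]) auto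
  have g\<phi>: "\<phi> x \<le> g x" for x unfolding g_def by (intro cINF_greatest le) auto
  have gb: "\<bar>g x\<bar> \<le> a" for x using g\<psi>[of x] g\<phi>[of x] \<phi>b[of x] \<psi>b[of x] by linarith
  have lip: "g x \<le> g y + b * dist x y" for x y
  proof -
    have "(INF h\<in>range (\<lambda>w x. b * dist x w - \<psi> w). h x) \<le> (INF h\<in>range (\<lambda>w x. b * dist x w - \<psi> w). h y) + b * dist x y"
    proof (rule cINF_le_cINF_add[where L="- a"])
      fix h assume "h \<in> range (\<lambda>w x. b * dist x w - \<psi> w)"
      then obtain w where h: "h = (\<lambda>x. b * dist x w - \<psi> w)" by auto
      show "- a \<le> h x" unfolding h by (rule lower)
      have "b * dist x w \<le> b * (dist x y + dist y w)" using b by (intro mult_left_mono dist_triangle) auto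
      then show "h x \<le> h y + b * dist x y" unfolding h by (simp add: distrib_left)
    qed auto
    then show ?thesis by (simp add: g_def image_image)
  qed
  have "continuous_on UNIV g"
  proof (rule continuous_on_of_modulus)
    fix e :: real assume e: "e > 0"
    have "g x \<le> g y + e" if "dist x y < e / b" for x y
      using lip[of x y] that b by (simp add: less_divide_eq mult.commute)
    then show "\<exists>d>0. \<forall>x y. dist x y < d \<longrightarrow> g x \<le> g y + e" using e b by (intro exI[of _ "e / b"]) auto
  qed
  then have "g \<in> bcontfun" using gb by (intro bcontfun_normI[of _ a]) auto
  then obtain f where f: "g = apply_bcontfun f" by (rule bcontfunE)
  have "\<bar>g x - g y\<bar> \<le> b * dist x y" for x y
    using lip[of x y] lip[of y x] by (simp add: dist_commute abs_le_iff)
  then have fF: "f \<in> F_class a b" using gb by (simp add: F_class_iff[OF b] f)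
  have m: "g \<in> borel_measurable borel" "\<phi> \<in> borel_measurable borel" "\<psi> \<in> borel_measurable borel"
    unfolding f \<phi>_def[abs_def] \<psi>_def[abs_def] by measurable
  have "(\<integral>x. \<phi> x \<partial>\<mu>) \<le> (\<integral>x. g x \<partial>\<mu>)"
    using g\<phi> by (intro integral_mono integrable_bounded_borel[OF \<mu> m(2) \<phi>b] integrable_bounded_borel[OF \<mu> m(1) gb])
  moreover have "(\<integral>x. \<psi> x \<partial>\<nu>) \<le> (\<integral>x. - g x \<partial>\<nu>)"
    using g\<psi> integrable_bounded_borel[OF \<nu> m(1) gb]
    by (intro integral_mono integrable_bounded_borel[OF \<nu> m(3) \<psi>b] Bochner_Integration.integrable_minus) (auto simp: le_minus_iff)
  ultimately have "I_integral a \<mu> \<phi>1 + I_integral a \<nu> \<phi>2 \<le> (\<integral>x. g x \<partial>\<mu>) - (\<integral>x. g x \<partial>\<nu>)"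
    using I_integral_eq[OF a \<phi>a(1), of \<mu>] I_integral_eq[OF a \<phi>a(2), of \<nu>] by (simp flip: \<phi>_def \<psi>_def)
  also have "\<dots> = signed_integral (signed_diff \<mu> \<nu>) (apply_bcontfun f)"
    using signed_integral_signed_diff[OF \<mu> \<nu> m(1) gb] by (simp add: f)
  finally show ?thesis using that fF by blast
qed

text \<open>For every \<open>e > 0\<close> there are an admissible primal value and a dual pair
  within \<open>e\<close> of each other. With weak duality this closes the gap without exhibiting an
  optimiser on either side; \<open>e = 1\<close> shows that the primal set is nonempty.\<close>

lemma gen_wasserstein_powr_eq_SUP:
  fixes \<mu> \<nu> :: "'a::{metric_space, second_countable_topology} measure"
  assumes a: "a > 0" and b: "b > 0" and p: "p > 0"
    and \<mu>: "\<mu> \<in> finite_borel_measures" and \<nu>: "\<nu> \<in> finite_borel_measures"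
  shows "ereal (gen_wasserstein a b p \<mu> \<nu> powr p) =
    (SUP (\<phi>1, \<phi>2)\<in>Phi_W a b p. ereal (I_integral a \<mu> \<phi>1 + I_integral a \<nu> \<phi>2))"
proof -
  define S where "S = {a * total_variation (signed_diff \<mu> \<mu>1') + a * total_variation (signed_diff \<nu> \<mu>2')
             + b powr p * wasserstein p \<mu>1' \<mu>2' powr p | \<mu>1' \<mu>2'.
           \<mu>1' \<in> finite_moment_measures p \<and> \<mu>2' \<in> finite_moment_measures p \<and>
           measure \<mu>1' UNIV = measure \<mu>2' UNIV}"
  have S0: "0 \<le> s" if "s \<in> S" for s
    using that a b total_variation_nonneg[OF \<mu>] total_variation_nonneg[OF \<nu>]
    by (auto simp: S_def dest!: finite_moment_measuresD intro!: add_nonneg_nonneg)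
  have approx: "\<exists>s\<in>S. \<exists>(\<phi>1, \<phi>2)\<in>Phi_W a b p. s \<le> I_integral a \<mu> \<phi>1 + I_integral a \<nu> \<phi>2 + e" if "e > 0" for e
  proof (rule approx_strong_duality[OF a b p that \<mu> \<nu>])
    fix \<mu>1 \<mu>2 :: "'a measure" and \<phi>1 \<phi>2 :: "'a \<Rightarrow>\<^sub>C real"
    let ?s = "a * total_variation (signed_diff \<mu> \<mu>1) + a * total_variation (signed_diff \<nu> \<mu>2)
      + b powr p * wasserstein p \<mu>1 \<mu>2 powr p"
    assume "\<mu>1 \<in> finite_moment_measures p" "\<mu>2 \<in> finite_moment_measures p"
      "measure \<mu>1 UNIV = measure \<mu>2 UNIV" and \<phi>: "(\<phi>1, \<phi>2) \<in> Phi_W a b p"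
      "?s \<le> I_integral a \<mu> \<phi>1 + I_integral a \<nu> \<phi>2 + e"
    then have "?s \<in> S" unfolding S_def by blast
    with \<phi> show ?thesis by (intro bexI[of _ ?s] bexI[of _ "(\<phi>1, \<phi>2)"]) simp_all
  qed
  have weak: "I_integral a \<mu> \<phi>1 + I_integral a \<nu> \<phi>2 \<le> s" if "s \<in> S" "(\<phi>1, \<phi>2) \<in> Phi_W a b p" for s \<phi>1 \<phi>2
    using that weak_duality[OF a b p \<mu> \<nu>] by (auto simp: S_def)
  have ne: "S \<noteq> {}" using approx[of 1] by auto
  have bdd: "bdd_below S" using S0 by (rule bdd_belowI)
  \<comment> \<open>The powers \<open>1 / p\<close> and \<open>p\<close> cancel because the infimum
    is nonnegative.\<close>
  have "gen_wasserstein a b p \<mu> \<nu> powr p = Inf S"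
    using cInf_greatest[OF ne S0] p by (simp add: gen_wasserstein_def powr_powr flip: S_def)
  moreover have "ereal (Inf S) = (SUP (\<phi>1, \<phi>2)\<in>Phi_W a b p. ereal (I_integral a \<mu> \<phi>1 + I_integral a \<nu> \<phi>2))"
  proof (rule antisym)
    show "(SUP (\<phi>1, \<phi>2)\<in>Phi_W a b p. ereal (I_integral a \<mu> \<phi>1 + I_integral a \<nu> \<phi>2)) \<le> ereal (Inf S)"
      using weak ne by (auto intro!: SUP_least cInf_greatest)
    show "ereal (Inf S) \<le> (SUP (\<phi>1, \<phi>2)\<in>Phi_W a b p. ereal (I_integral a \<mu> \<phi>1 + I_integral a \<nu> \<phi>2))"
    proof (rule ereal_le_epsilon2)
      fix e :: real assume "e > 0"
      then obtain s \<phi>1 \<phi>2 where s: "s \<in> S" "(\<phi>1, \<phi>2) \<in> Phi_W a b p" "s \<le> I_integral a \<mu> \<phi>1 + I_integral a \<nu> \<phi>2 + e"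
        using approx[OF \<open>e > 0\<close>] by auto
      have "ereal (Inf S) \<le> ereal (I_integral a \<mu> \<phi>1 + I_integral a \<nu> \<phi>2) + ereal e"
        using cInf_lower[OF s(1) bdd] s(3) by simp
      also have "\<dots> \<le> (SUP (\<phi>1, \<phi>2)\<in>Phi_W a b p. ereal (I_integral a \<mu> \<phi>1 + I_integral a \<nu> \<phi>2)) + ereal e"
        using s(2) by (intro add_right_mono SUP_upper2[of "(\<phi>1, \<phi>2)"]) auto
      finally show "ereal (Inf S) \<le> (SUP (\<phi>1, \<phi>2)\<in>Phi_W a b p. ereal (I_integral a \<mu> \<phi>1 + I_integral a \<nu> \<phi>2)) + ereal e" .
    qed
  qed
  ultimately show ?thesis by simp
qed

theorem corollary1p3:
  fixes a b p :: real and \<mu> \<nu> :: "'a::polish_space measure"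
  assumes "locally compact (UNIV :: 'a set)"
    and "a > 0" and "b > 0" and "p \<ge> 1"
    and "\<mu> \<in> finite_borel_measures" and "\<nu> \<in> finite_borel_measures"
  shows "ereal (gen_wasserstein a b p \<mu> \<nu> powr p) =
           (SUP (\<phi>1, \<phi>2)\<in>Phi_W a b p. ereal (I_integral a \<mu> \<phi>1 + I_integral a \<nu> \<phi>2)) \<and>
         ereal (gen_wasserstein a b 1 \<mu> \<nu>) =
           (SUP f\<in>F_class a b. ereal (signed_integral (signed_diff \<mu> \<nu>) (apply_bcontfun f)))"
proof
  note a = assms(2) and b = assms(3) and \<mu> = assms(5) and \<nu> = assms(6)
  show "ereal (gen_wasserstein a b p \<mu> \<nu> powr p) =
      (SUP (\<phi>1, \<phi>2)\<in>Phi_W a b p. ereal (I_integral a \<mu> \<phi>1 + I_integral a \<nu> \<phi>2))"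
    using assms by (intro gen_wasserstein_powr_eq_SUP) auto
  \<comment> \<open>The second claim is the first at exponent 1 with the supremum taken over pairs
    \<open>(f, - f)\<close>: every such pair is admissible, and every admissible pair is dominated
    by one of them.\<close>
  have "ereal (gen_wasserstein a b 1 \<mu> \<nu>) = ereal (gen_wasserstein a b 1 \<mu> \<nu> powr 1)"
    by (simp add: gen_wasserstein_def)
  also have "\<dots> = (SUP (\<phi>1, \<phi>2)\<in>Phi_W a b 1. ereal (I_integral a \<mu> \<phi>1 + I_integral a \<nu> \<phi>2))"
    using a b \<mu> \<nu> by (intro gen_wasserstein_powr_eq_SUP) auto
  also have "\<dots> = (SUP f\<in>F_class a b. ereal (signed_integral (signed_diff \<mu> \<nu>) (apply_bcontfun f)))"
  proof (rule antisym)
    show "(SUP (\<phi>1, \<phi>2)\<in>Phi_W a b 1. ereal (I_integral a \<mu> \<phi>1 + I_integral a \<nu> \<phi>2))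
        \<le> (SUP f\<in>F_class a b. ereal (signed_integral (signed_diff \<mu> \<nu>) (apply_bcontfun f)))"
    proof (intro SUP_least, clarify)
      fix \<phi>1 \<phi>2 :: "'a \<Rightarrow>\<^sub>C real" assume "(\<phi>1, \<phi>2) \<in> Phi_W a b 1"
      then obtain f where "f \<in> F_class a b"
        "I_integral a \<mu> \<phi>1 + I_integral a \<nu> \<phi>2 \<le> signed_integral (signed_diff \<mu> \<nu>) (apply_bcontfun f)"
        using F_class_dominates_Phi_W[OF a b \<mu> \<nu>] by blast
      then show "ereal (I_integral a \<mu> \<phi>1 + I_integral a \<nu> \<phi>2)
          \<le> (SUP f\<in>F_class a b. ereal (signed_integral (signed_diff \<mu> \<nu>) (apply_bcontfun f)))"
        by (intro SUP_upper2[of f]) auto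
    qed
    show "(SUP f\<in>F_class a b. ereal (signed_integral (signed_diff \<mu> \<nu>) (apply_bcontfun f)))
        \<le> (SUP (\<phi>1, \<phi>2)\<in>Phi_W a b 1. ereal (I_integral a \<mu> \<phi>1 + I_integral a \<nu> \<phi>2))"
    proof (rule SUP_least)
      fix f :: "'a \<Rightarrow>\<^sub>C real" assume f: "f \<in> F_class a b"
      show "ereal (signed_integral (signed_diff \<mu> \<nu>) (apply_bcontfun f))
          \<le> (SUP (\<phi>1, \<phi>2)\<in>Phi_W a b 1. ereal (I_integral a \<mu> \<phi>1 + I_integral a \<nu> \<phi>2))"
        using signed_integral_F_class[OF a b \<mu> \<nu> f] by (intro SUP_upper2[of "(f, - f)"]) auto
    qed
  qed
  finally show "ereal (gen_wasserstein a b 1 \<mu> \<nu>) =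
      (SUP f\<in>F_class a b. ereal (signed_integral (signed_diff \<mu> \<nu>) (apply_bcontfun f)))" .
qed

end
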